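(* Let $(C^*,d)$, $C^*=\bigoplus_{q=0}^N C^q$, be a finite-dimensional cochain complex of complex vector spaces, $d:C^q\to C^{q+1}$, with given ordered bases $\mathbf c^q=\{c^{q,j}\}_{j=1}^{n_q}$ of $C^q$ and $\mathbf h^q=\{h^{q,j}\}_{j=1}^{v_q}$ of $H^q(C^*,d)$. Let $(\cdot,\cdot):C^q\times C^q\to\mathbb C$ be the non-degenerate complex bilinear (not Hermitian) pairing with $(c^{q,i},c^{q,j})=\delta_{i,j}$, let $d^*:C^{q}\to C^{q-1}$ be the transpose of $d$, $(da,b)=(a,d^*b)$, and let $\mathbf h'_q=\{h'_{q,j}\}_{j=1}^{v_q}$ be the basis of $H_q(C^*,d^* )$ dual to $\mathbf h^q$ under the induced pairing between $H^q(C^*,d)$ and $H_q(C^*,d^* )$. Then $$torsion(C^*,d,d^*,\{\mathbf h^q\},\{\mathbf h'_q\})=\tau(C^*,d,\{\mathbf h^q\},\{\mathbf c^q\})^2 .$$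
   Context: For ordered bases $X,Y$ of a finite-dimensional space, $[Y/X]$ is the number with $\wedge Y=[Y/X]\wedge X$ (ordered wedge products). For $C^*$ with differentials $d$ of degree $+1$ and $d^*$ of degree $-1$ (each of square zero): $B^q=dC^{q-1}$, $B_q=d^*C^{q+1}$, $H^q=H^q(C^*,d)$, $H_q=H_q(C^*,d^* )$. Choose ordered bases $\mathbf b^q$ of $B^q$ and lifts $\tilde{\mathbf b}^q\subset C^{q-1}$ with $d\tilde{\mathbf b}^q=\mathbf b^q$; ordered bases $\mathbf b_q$ of $B_q$ and lifts $\tilde{\mathbf b}_q\subset C^{q+1}$ with $d^*\tilde{\mathbf b}_q=\mathbf b_q$; representatives $\mathbf{lh}^q\subset\ker d|C^q$ of $\mathbf h^q$ and $\mathbf{lh}_q\subset\ker d^*|C^q$ of $\mathbf h'_q$. Then $$\tau(C^*,d,\{\mathbf h^q\},\{\mathbf c^q\})=\Big[\prod_{q=0}^N[\mathbf b^q,\mathbf{lh}^q,\tilde{\mathbf b}^{q+1}/\mathbf c^q]^{(-1)^q}\Big]^{-1},$$ $$torsion(C^*,d,d^*,\{\mathbf h^q\},\{\mathbf h'_q\})=(-1)^{S(C^* )}\prod_{q}[\mathbf b^q,\mathbf{lh}^q,\tilde{\mathbf b}^{q+1}/\mathbf b_q,\mathbf{lh}_q,\tilde{\mathbf b}_{q-1}]^{(-1)^{q+1}},$$ $$S(C^* )=\sum_q\big(\dim B_{q-1}\dim B^{q+1}+\dim B^{q+1}\dim H_q+\dim B_{q-1}\dim H^q\big);$$ both are independent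 of the auxiliary choices. *)

theory Defs
  imports Complex_Main "HOL-Library.Set_Algebras"
begin

text \<open>A copy of \<open>vector_space\<close>: definitions made in the latter would also be instantiated at the
  existing interpretation \<open>real_vector\<close>, under the same names.\<close>

locale vec_space_over = vector_space scale
  for scale :: "'a::field \<Rightarrow> 'b::ab_group_add \<Rightarrow> 'b"
begin

subsection \<open>Ordered bases and ratios of top exterior products\<close>

definition ordered_basis :: "'b set \<Rightarrow> 'b list \<Rightarrow> bool" where
  "ordered_basis V xs \<longleftrightarrow> distinct xs \<and> independent (set xs) \<and> span (set xs) = V"

text \<open>Alternating \<open>n\<close>-linear forms on \<open>V\<close>, as functions on lists; their values on lists that
  are not of length \<open>n\<close> with entries in \<open>V\<close> are irrelevant.\<close>

definition alternating_form :: "'b set \<Rightarrow> nat \<Rightarrow> ('b list \<Rightarrow> 'a) \<Rightarrow> bool" where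
  "alternating_form V n \<omega> \<longleftrightarrow>
     (\<forall>xs. length xs = n \<and> set xs \<subseteq> V \<longrightarrow>
        (\<forall>i<n. \<forall>x\<in>V. \<forall>y\<in>V. \<omega> (xs[i := x + y]) = \<omega> (xs[i := x]) + \<omega> (xs[i := y])) \<and>
        (\<forall>i<n. \<forall>x\<in>V. \<forall>a. \<omega> (xs[i := scale a x]) = a * \<omega> (xs[i := x])) \<and>
        (\<forall>i<n. \<forall>j<n. i \<noteq> j \<and> xs ! i = xs ! j \<longrightarrow> \<omega> xs = 0))"

text \<open>The \<open>n\<close>-th exterior power of a finite-dimensional \<open>V\<close> is realised as the dual of the space of
  alternating \<open>n\<close>-forms: \<open>x\<^sub>1 \<and> \<dots> \<and> x\<^sub>n\<close> is evaluation of forms at \<open>(x\<^sub>1, \<dots>, x\<^sub>n)\<close>.\<close>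

definition wedge :: "'b set \<Rightarrow> 'b list \<Rightarrow> ('b list \<Rightarrow> 'a) \<Rightarrow> 'a" where
  "wedge V xs = (\<lambda>\<omega>. if alternating_form V (length xs) \<omega> then \<omega> xs else 0)"

text \<open>\<open>basis_ratio V Y X\<close> is \<open>[Y/X]\<close>.\<close>

definition basis_ratio :: "'b set \<Rightarrow> 'b list \<Rightarrow> 'b list \<Rightarrow> 'a" where
  "basis_ratio V Y X = (THE k. wedge V Y = (\<lambda>\<omega>. k * wedge V X \<omega>))"


subsection \<open>Quotients of a subspace \<open>Z\<close> by a subspace \<open>B\<close>\<close>

definition quot_space :: "'b set \<Rightarrow> 'b set \<Rightarrow> 'b set set" where
  "quot_space Z B = (\<lambda>z. z +o B) ` Z"

text \<open>The linear combination of the cosets \<open>hs\<close> with coefficients \<open>as\<close>. Adding \<open>B\<close> to the Minkowski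
  sum matters only if all coefficients vanish.\<close>

definition quot_lincomb :: "'b set \<Rightarrow> 'a list \<Rightarrow> 'b set list \<Rightarrow> 'b set" where
  "quot_lincomb B as hs = (\<Sum>i<length hs. scale (as ! i) ` (hs ! i)) + B"

definition quot_ordered_basis :: "'b set \<Rightarrow> 'b set \<Rightarrow> 'b set list \<Rightarrow> bool" where
  "quot_ordered_basis Z B hs \<longleftrightarrow> set hs \<subseteq> quot_space Z B \<and>
     (\<forall>A\<in>quot_space Z B. \<exists>!as. length as = length hs \<and> quot_lincomb B as hs = A)"

definition quot_dim :: "'b set \<Rightarrow> 'b set \<Rightarrow> nat" where
  "quot_dim Z B = (THE n. \<exists>hs. quot_ordered_basis Z B hs \<and> length hs = n)"


subsection \<open>Cohomology and homology\<close>

text \<open>Here \<open>\<delta>\<close> is a differential of degree \<open>e\<close>: below, \<open>d\<close> with \<open>e = 1\<close> or \<open>d\<^sup>*\<close> with \<open>e = -1\<close>.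
  Degrees are integers and the complex vanishes outside \<open>{0..N}\<close>.\<close>

definition cycles :: "(int \<Rightarrow> 'b set) \<Rightarrow> ('b \<Rightarrow> 'b) \<Rightarrow> int \<Rightarrow> 'b set" where
  "cycles C \<delta> q = {x \<in> C q. \<delta> x = 0}"

definition boundaries :: "(int \<Rightarrow> 'b set) \<Rightarrow> ('b \<Rightarrow> 'b) \<Rightarrow> int \<Rightarrow> int \<Rightarrow> 'b set" where
  "boundaries C \<delta> e q = \<delta> ` C (q - e)"

definition homology_basis ::
    "(int \<Rightarrow> 'b set) \<Rightarrow> ('b \<Rightarrow> 'b) \<Rightarrow> int \<Rightarrow> int \<Rightarrow> 'b set list \<Rightarrow> bool" where
  "homology_basis C \<delta> e q hs \<longleftrightarrow> quot_ordered_basis (cycles C \<delta> q) (boundaries C \<delta> e q) hs"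

definition homology_dim :: "(int \<Rightarrow> 'b set) \<Rightarrow> ('b \<Rightarrow> 'b) \<Rightarrow> int \<Rightarrow> int \<Rightarrow> nat" where
  "homology_dim C \<delta> e q = quot_dim (cycles C \<delta> q) (boundaries C \<delta> e q)"


subsection \<open>The two torsions\<close>

text \<open>Bases \<open>b q\<close> of the boundaries, lifts \<open>bt q\<close> of them along \<open>\<delta>\<close>, and representatives \<open>lh q\<close> of
  the homology classes \<open>h q\<close> (an element of the coset \<open>h q ! i\<close> for each \<open>i\<close>).\<close>

definition auxiliary_choice ::
    "nat \<Rightarrow> (int \<Rightarrow> 'b set) \<Rightarrow> ('b \<Rightarrow> 'b) \<Rightarrow> int \<Rightarrow> (int \<Rightarrow> 'b set list) \<Rightarrow>
     (int \<Rightarrow> 'b list) \<Rightarrow> (int \<Rightarrow> 'b list) \<Rightarrow> (int \<Rightarrow> 'b list) \<Rightarrow> bool" where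
  "auxiliary_choice N C \<delta> e h b bt lh \<longleftrightarrow>
     (\<forall>q. ordered_basis (boundaries C \<delta> e q) (b q) \<and>
          set (bt q) \<subseteq> C (q - e) \<and> map \<delta> (bt q) = b q) \<and>
     (\<forall>q\<in>{0..int N}. list_all2 (\<in>) (lh q) (h q))"

text \<open>Both torsions are the common value of the defining expression over all auxiliary choices.\<close>

definition tau ::
    "nat \<Rightarrow> (int \<Rightarrow> 'b set) \<Rightarrow> ('b \<Rightarrow> 'b) \<Rightarrow> (int \<Rightarrow> 'b set list) \<Rightarrow> (int \<Rightarrow> 'b list) \<Rightarrow> 'a" where
  "tau N C d h c = (THE t. \<exists>b bt lh. auxiliary_choice N C d 1 h b bt lh \<and>
     t = inverse (\<Prod>q\<in>{0..int N}.
           basis_ratio (C q) (b q @ lh q @ bt (q + 1)) (c q) powi ((-1) ^ nat q)))"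

definition torsion_sign_exponent ::
    "nat \<Rightarrow> (int \<Rightarrow> 'b set) \<Rightarrow> ('b \<Rightarrow> 'b) \<Rightarrow> ('b \<Rightarrow> 'b) \<Rightarrow> nat" where
  "torsion_sign_exponent N C d ds = (\<Sum>q\<in>{0..int N}.
     dim (boundaries C ds (-1) (q - 1)) * dim (boundaries C d 1 (q + 1)) +
     dim (boundaries C d 1 (q + 1)) * homology_dim C ds (-1) q +
     dim (boundaries C ds (-1) (q - 1)) * homology_dim C d 1 q)"

definition torsion ::
    "nat \<Rightarrow> (int \<Rightarrow> 'b set) \<Rightarrow> ('b \<Rightarrow> 'b) \<Rightarrow> ('b \<Rightarrow> 'b) \<Rightarrow>
     (int \<Rightarrow> 'b set list) \<Rightarrow> (int \<Rightarrow> 'b set list) \<Rightarrow> 'a" where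
  "torsion N C d ds h h' = (THE t. \<exists>b bt lh b' bt' lh'.
     auxiliary_choice N C d 1 h b bt lh \<and> auxiliary_choice N C ds (-1) h' b' bt' lh' \<and>
     t = (-1) ^ torsion_sign_exponent N C d ds *
         (\<Prod>q\<in>{0..int N}.
           basis_ratio (C q) (b q @ lh q @ bt (q + 1)) (b' q @ lh' q @ bt' (q - 1))
             powi ((-1) ^ nat (q + 1))))"


subsection \<open>Pairings\<close>

definition bilinear_pairing :: "'b set \<Rightarrow> ('b \<Rightarrow> 'b \<Rightarrow> 'a) \<Rightarrow> bool" where
  "bilinear_pairing V P \<longleftrightarrow>
     (\<forall>x\<in>V. \<forall>y\<in>V. \<forall>z\<in>V. P (x + y) z = P x z + P y z \<and> P z (x + y) = P z x + P z y) \<and>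
     (\<forall>x\<in>V. \<forall>y\<in>V. \<forall>a. P (scale a x) y = a * P x y \<and> P x (scale a y) = a * P x y)"

definition nondegenerate_pairing :: "'b set \<Rightarrow> ('b \<Rightarrow> 'b \<Rightarrow> 'a) \<Rightarrow> bool" where
  "nondegenerate_pairing V P \<longleftrightarrow>
     (\<forall>x\<in>V. (\<forall>y\<in>V. P x y = 0) \<longrightarrow> x = 0) \<and> (\<forall>y\<in>V. (\<forall>x\<in>V. P x y = 0) \<longrightarrow> y = 0)"

definition induced_pairing :: "('b \<Rightarrow> 'b \<Rightarrow> 'a) \<Rightarrow> 'b set \<Rightarrow> 'b set \<Rightarrow> 'a" where
  "induced_pairing P A B = (THE k. \<forall>x\<in>A. \<forall>y\<in>B. P x y = k)"

definition transpose_differential ::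
    "(int \<Rightarrow> 'b set) \<Rightarrow> ('b \<Rightarrow> 'b \<Rightarrow> 'a) \<Rightarrow> ('b \<Rightarrow> 'b) \<Rightarrow> ('b \<Rightarrow> 'b) \<Rightarrow> bool" where
  "transpose_differential C P d ds \<longleftrightarrow>
     Vector_Spaces.linear scale scale ds \<and>
     (\<forall>q. ds ` C q \<subseteq> C (q - 1)) \<and>
     (\<forall>q. \<forall>x\<in>C (q - 1). \<forall>y\<in>C q. P (d x) y = P x (ds y))"

end


text \<open>The whole type is the total space \<open>C\<^sup>*\<close>, the internal direct sum of the \<open>C q\<close>.\<close>

locale cochain_complex = vec_space_over scale
  for scale :: "'a::field \<Rightarrow> 'b::ab_group_add \<Rightarrow> 'b" +
  fixes N :: nat and C :: "int \<Rightarrow> 'b set" and d :: "'b \<Rightarrow> 'b"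
  assumes subspace_C: "subspace (C q)"
    and finite_dim_C: "\<exists>S. finite S \<and> span S = C q"
    and C_outside: "q \<notin> {0..int N} \<Longrightarrow> C q = {0}"
    and direct_sum: "\<exists>!y. (\<forall>q. y q \<in> C q) \<and> x = (\<Sum>q\<in>{0..int N}. y q)"
    and linear_d: "Vector_Spaces.linear scale scale d"
    and d_degree: "d ` C q \<subseteq> C (q + 1)"
    and d_d: "d (d x) = 0"

end

theory Submission
  imports Defs "Jordan_Normal_Form.Determinant"
begin

text \<open>Let \<open>X q = b q @ lh q @ bt (q + 1)\<close> and \<open>Y q = b' q @ lh' q @ bt' (q - 1)\<close> be the bases of
  \<open>C q\<close> given by auxiliary choices for \<open>d\<close> and \<open>d\<^sup>*\<close>. As \<open>c q\<close> is orthonormal, the Gram determinant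
  of \<open>X q\<close> against \<open>Y q\<close> is \<open>[X q/c q] [Y q/c q]\<close>. Reversing the three blocks of \<open>Y q\<close>, at the cost
  of the sign of the \<open>q\<close>-th summand of \<open>S(C\<^sup>*)\<close>, makes the Gram matrix block triangular, with diagonal
  blocks \<open>A q\<close>, the identity and \<open>A (q + 1)\<close>, where \<open>A q\<close> is the Gram matrix of \<open>b q\<close> against
  \<open>bt' (q - 1)\<close>. The alternating product of the Gram determinants therefore telescopes to the sign
  \<open>(-1)\<close> to the power \<open>S(C\<^sup>*)\<close>. This expresses the product defining \<open>\<tau>\<close> through \<open>Y\<close> alone, which shows
  that it does not depend on \<open>X\<close>, and \<open>[X q/Y q] = [X q/c q] / [Y q/c q]\<close> turns the torsion
  into \<open>\<tau>\<^sup>2\<close>.\<close>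

subsection \<open>Ordered bases and quotients\<close>

context vec_space_over
begin

text \<open>Coefficients belong to positions rather than to vectors, so a list with a repeated entry
  satisfies a nontrivial relation. They are a function on all naturals, so that those of a
  concatenation are obtained by a shift of the index.\<close>

definition list_lincomb :: "(nat \<Rightarrow> 'a) \<Rightarrow> 'b list \<Rightarrow> 'b" where
  "list_lincomb a xs = (\<Sum>i<length xs. scale (a i) (xs ! i))"

lemma list_lincomb_Nil [simp]: "list_lincomb a [] = 0"
  by (simp add: list_lincomb_def)

lemma list_lincomb_snoc:
  "list_lincomb a (xs @ [x]) = list_lincomb a xs + scale (a (length xs)) x"
  by (simp add: list_lincomb_def nth_append)

lemma list_lincomb_append:
  "list_lincomb a (xs @ ys) = list_lincomb a xs + list_lincomb (\<lambda>i. a (length xs + i)) ys"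
proof (induction ys rule: rev_induct)
  case (snoc y ys)
  then show ?case
    using list_lincomb_snoc[of a "xs @ ys" y] by (simp add: list_lincomb_snoc add.assoc)
qed simp

lemma list_lincomb_append_if:
  "list_lincomb (\<lambda>i. if i < length xs then a i else b (i - length xs)) (xs @ ys) =
     list_lincomb a xs + list_lincomb b ys"
  unfolding list_lincomb_append by (simp add: list_lincomb_def)

lemma list_lincomb_cong:
  "(\<And>i. i < length xs \<Longrightarrow> a i = b i) \<Longrightarrow> list_lincomb a xs = list_lincomb b xs"
  by (simp add: list_lincomb_def)

lemma list_lincomb_zero: "(\<And>i. i < length xs \<Longrightarrow> a i = 0) \<Longrightarrow> list_lincomb a xs = 0"
  by (simp add: list_lincomb_def)

lemma list_lincomb_in:
  "subspace V \<Longrightarrow> set xs \<subseteq> V \<Longrightarrow> list_lincomb a xs \<in> V"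
  unfolding list_lincomb_def by (intro subspace_sum subspace_scale) auto

lemma linear_list_lincomb:
  assumes "Vector_Spaces.linear scale scale f"
  shows "f (list_lincomb a xs) = list_lincomb a (map f xs)"
proof -
  interpret f: Vector_Spaces.linear scale scale f by fact
  show ?thesis by (simp add: list_lincomb_def f.sum f.scale)
qed

lemma span_set_eq_list_lincomb: "span (set xs) = range (\<lambda>a. list_lincomb a xs)"
proof
  show "range (\<lambda>a. list_lincomb a xs) \<subseteq> span (set xs)"
    using list_lincomb_in[OF subspace_span span_superset] by auto
  show "span (set xs) \<subseteq> range (\<lambda>a. list_lincomb a xs)"
  proof (rule span_minimal)
    show "set xs \<subseteq> range (\<lambda>a. list_lincomb a xs)"
    proof
      fix x assume "x \<in> set xs"
      then obtain k where k: "k < length xs" "x = xs ! k" by (auto simp: in_set_conv_nth)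
      have "list_lincomb (\<lambda>i. if i = k then 1 else 0) xs
          = (\<Sum>i<length xs. if i = k then xs ! i else 0)"
        unfolding list_lincomb_def by (intro sum.cong) auto
      then have "x = list_lincomb (\<lambda>i. if i = k then 1 else 0) xs" using k by simp
      then show "x \<in> range (\<lambda>a. list_lincomb a xs)" by blast
    qed
    show "subspace (range (\<lambda>a. list_lincomb a xs))"
      unfolding subspace_def
    proof (intro conjI ballI allI)
      show "0 \<in> range (\<lambda>a. list_lincomb a xs)"
        using list_lincomb_zero[of xs "\<lambda>_. 0"] by (metis rangeI)
    next
      fix x y assume "x \<in> range (\<lambda>a. list_lincomb a xs)" "y \<in> range (\<lambda>a. list_lincomb a xs)"
      then obtain a b where "x = list_lincomb a xs" "y = list_lincomb b xs" by blast
      then have "x + y = list_lincomb (\<lambda>i. a i + b i) xs"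
        by (simp add: list_lincomb_def scale_left_distrib sum.distrib)
      then show "x + y \<in> range (\<lambda>a. list_lincomb a xs)" by blast
    next
      fix k x assume "x \<in> range (\<lambda>a. list_lincomb a xs)"
      then obtain a where "x = list_lincomb a xs" by blast
      then have "scale k x = list_lincomb (\<lambda>i. k * a i) xs"
        by (simp add: list_lincomb_def scale_sum_right)
      then show "scale k x \<in> range (\<lambda>a. list_lincomb a xs)" by blast
    qed
  qed
qed

lemma list_lincomb_distinct:
  assumes "distinct xs"
  shows "list_lincomb (\<lambda>i. u (xs ! i)) xs = (\<Sum>v\<in>set xs. scale (u v) v)"
  unfolding list_lincomb_def
  using sum.reindex_bij_betw[OF bij_betw_nth[OF assms refl refl], of "\<lambda>v. scale (u v) v"] .

text \<open>Independence by position captures distinctness and independence of the set at once. In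
  this form bases can be concatenated without asking whether the blocks are disjoint.\<close>

lemma ordered_basis_iff:
  "ordered_basis V xs \<longleftrightarrow>
     (\<forall>a. list_lincomb a xs = 0 \<longrightarrow> (\<forall>i<length xs. a i = 0)) \<and> V = range (\<lambda>a. list_lincomb a xs)"
  (is "_ \<longleftrightarrow> ?I \<and> _")
proof -
  have "distinct xs \<and> independent (set xs) \<longleftrightarrow> ?I"
  proof safe
    fix a i assume d: "distinct xs" and ind: "independent (set xs)"
      and 0: "list_lincomb a xs = 0" and i: "i < length xs"
    \<comment> \<open>Since \<open>xs\<close> is distinct, indexing is injective and the
      coefficients can be carried over from positions to vectors.\<close>
    define u where "u v = a (the_inv_into {..<length xs} ((!) xs) v)" for v
    have inj: "inj_on ((!) xs) {..<length xs}" using d by (simp add: inj_on_nth)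
    have u: "u (xs ! j) = a j" if "j < length xs" for j
      using that by (simp add: u_def the_inv_into_f_f[OF inj])
    have "list_lincomb a xs = (\<Sum>v\<in>set xs. scale (u v) v)"
      using list_lincomb_distinct[OF d, of u] list_lincomb_cong[of xs "\<lambda>i. u (xs ! i)" a] u by simp
    with 0 have "(\<Sum>v\<in>set xs. scale (u v) v) = 0" by simp
    moreover have "xs ! i \<in> set xs" using i by simp
    ultimately have "u (xs ! i) = 0"
      using ind unfolding dependent_finite[OF finite_set] by blast
    then show "a i = 0" using u i by simp
  next
    assume I: ?I
    show d: "distinct xs"
    proof (rule ccontr)
      assume "\<not> distinct xs"
      then obtain i j where ij: "i < length xs" "j < length xs" "i \<noteq> j" "xs ! i = xs ! j"
        by (auto simp: distinct_conv_nth)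
      \<comment> \<open>The relation saying that the \<open>i\<close>-th entry minus the equal
        \<open>j\<close>-th entry is zero.\<close>
      let ?a = "\<lambda>k. (if k = i then 1 else 0) - (if k = j then 1 else 0) :: 'a"
      have "list_lincomb ?a xs
          = (\<Sum>k<length xs. (if k = i then xs ! k else 0) - (if k = j then xs ! k else 0))"
        unfolding list_lincomb_def by (intro sum.cong) (auto simp: scale_left_diff_distrib)
      also have "\<dots> = 0" using ij by (simp add: sum_subtractf)
      finally have "?a i = 0" by (rule I[rule_format, OF _ ij(1)])
      then show False using ij(3) by simp
    qed
    show False if "dependent (set xs)"
    proof -
      from that obtain u v where u: "v \<in> set xs" "u v \<noteq> 0" "(\<Sum>v\<in>set xs. scale (u v) v) = 0"
        using dependent_finite[of "set xs"] by auto
      then have "u (xs ! i) = 0" if "i < length xs" for i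
        using list_lincomb_distinct[OF d, of u] I[rule_format, of "\<lambda>i. u (xs ! i)" i] that by simp
      with u(1,2) show ?thesis by (metis in_set_conv_nth)
    qed
  qed
  then show ?thesis
    unfolding ordered_basis_def span_set_eq_list_lincomb by blast
qed

lemma ordered_basis_independent:
  "ordered_basis V xs \<Longrightarrow> list_lincomb a xs = 0 \<Longrightarrow> i < length xs \<Longrightarrow> a i = 0"
  by (simp add: ordered_basis_iff)

lemma ordered_basis_span: "ordered_basis V xs \<Longrightarrow> span (set xs) = V"
  by (simp add: ordered_basis_def)

lemma ordered_basis_subset: "ordered_basis V xs \<Longrightarrow> set xs \<subseteq> V"
  using span_superset by (auto simp: ordered_basis_def)

lemma ordered_basis_subspace: "ordered_basis V xs \<Longrightarrow> subspace V"
  using subspace_span by (auto simp: ordered_basis_def)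

lemma ordered_basis_expand:
  assumes "ordered_basis V xs" "v \<in> V"
  obtains a where "v = list_lincomb a xs"
  using assms by (auto simp: ordered_basis_iff)

lemma ordered_basis_length: "ordered_basis V xs \<Longrightarrow> length xs = dim V"
  using dim_eq_card_independent[of "set xs"] dim_span[of "set xs"]
  by (auto simp: ordered_basis_def distinct_card)

lemma ordered_basis_exists:
  assumes "finite S" "span S = V"
  shows "\<exists>xs. ordered_basis V xs"
proof -
  obtain B where B: "B \<subseteq> S" "independent B" "S \<subseteq> span B"
    by (rule maximal_independent_subset)
  then have "span B = V"
    using assms(2) span_mono[OF B(1)] span_minimal[OF B(3) subspace_span] by auto
  moreover obtain xs where "set xs = B" "distinct xs"
    using finite_distinct_list[OF finite_subset[OF B(1) assms(1)]] by blast
  ultimately show ?thesis using B(2) by (auto simp: ordered_basis_def)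
qed

text \<open>The exact sequence from the kernel of \<open>f\<close> through \<open>V\<close> to the
  image: applying \<open>f\<close> to a relation kills the kernel part and leaves a relation between
  basis vectors of the image.\<close>

lemma ordered_basis_kernel_append_lifts:
  assumes lin: "Vector_Spaces.linear scale scale f" and V: "subspace V"
    and Z: "ordered_basis {x \<in> V. f x = 0} zs"
    and B: "ordered_basis (f ` V) (map f ts)" and ts: "set ts \<subseteq> V"
  shows "ordered_basis V (zs @ ts)"
  unfolding ordered_basis_iff
proof (intro conjI allI impI)
  interpret f: Vector_Spaces.linear scale scale f by (rule lin)
  have fz: "f (list_lincomb a zs) = 0" for a
    using list_lincomb_in[OF ordered_basis_subspace[OF Z] ordered_basis_subset[OF Z], of a] by simp
  fix a i assume 0: "list_lincomb a (zs @ ts) = 0" and i: "i < length (zs @ ts)"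
  let ?t = "list_lincomb (\<lambda>i. a (length zs + i)) ts"
  have eq: "list_lincomb a zs + ?t = 0"
    using 0 by (simp add: list_lincomb_append)
  then have "f (list_lincomb a zs + ?t) = 0" by (simp add: f.zero)
  then have "list_lincomb (\<lambda>i. a (length zs + i)) (map f ts) = 0"
    using fz[of a] linear_list_lincomb[OF lin, of _ ts] by (simp add: f.add)
  then have t: "a (length zs + j) = 0" if "j < length ts" for j
    using ordered_basis_independent[OF B] that by fastforce
  then have "?t = 0" by (intro list_lincomb_zero) auto
  with eq have "list_lincomb a zs = 0" by simp
  then have z: "a j = 0" if "j < length zs" for j
    using ordered_basis_independent[OF Z] that by fastforce
  show "a i = 0" using t[of "i - length zs"] z[of i] i by (cases "i < length zs") auto
next
  interpret f: Vector_Spaces.linear scale scale f by (rule lin)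
  have sub: "set (zs @ ts) \<subseteq> V" using ordered_basis_subset[OF Z] ts by auto
  show "V = range (\<lambda>a. list_lincomb a (zs @ ts))"
  proof
    show "range (\<lambda>a. list_lincomb a (zs @ ts)) \<subseteq> V" using list_lincomb_in[OF V sub] by auto
    show "V \<subseteq> range (\<lambda>a. list_lincomb a (zs @ ts))"
    proof
      fix v assume v: "v \<in> V"
      then obtain b where b: "f v = list_lincomb b (map f ts)"
        using ordered_basis_expand[OF B] by blast
      \<comment> \<open>Subtracting a lift of \<open>f v\<close> moves \<open>v\<close> into the
        kernel.\<close>
      have "v - list_lincomb b ts \<in> {x \<in> V. f x = 0}"
        using v b list_lincomb_in[OF V ts]
        by (simp add: f.diff linear_list_lincomb[OF lin] subspace_diff[OF V])
      then obtain a where "v - list_lincomb b ts = list_lincomb a zs"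
        using ordered_basis_expand[OF Z] by blast
      then have "v = list_lincomb a zs + list_lincomb b ts" by (simp add: algebra_simps)
      then show "v \<in> range (\<lambda>a. list_lincomb a (zs @ ts))"
        using list_lincomb_append_if[of zs a b ts] by (metis rangeI)
    qed
  qed
qed

section \<open>Cosets and bases of quotient spaces\<close>

lemma quot_lincomb_representatives:
  assumes B: "subspace B" and hs: "list_all2 (\<lambda>x A. A = x +o B) ls hs"
  shows "quot_lincomb B as hs = list_lincomb ((!) as) ls +o B"
proof -
  have len: "length ls = length hs" and nth: "\<And>i. i < length hs \<Longrightarrow> hs ! i = ls ! i +o B"
    using hs by (auto simp: list_all2_conv_all_nth)
  have absorb: "A + B = B" if "0 \<in> A" "A \<subseteq> B" for A
  proof
    show "A + B \<subseteq> B" using that subspace_add[OF B] by (auto simp: set_plus_def)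
    show "B \<subseteq> A + B" using that(1) by (rule set_zero_plus2)
  qed
  then have BB: "B + B = B" using subspace_0[OF B] by blast
  \<comment> \<open>For \<open>k = 0\<close> the set \<open>scale k\<close> applied to a coset
    collapses to the zero vector alone; adding \<open>B\<close> turns it back into a coset.\<close>
  have coset: "scale k ` (x +o B) + B = scale k x +o B" for k x
  proof -
    have sub: "scale k ` B + B = B"
      using subspace_0[OF B] subspace_scale[OF B]
      by (intro absorb) (auto intro: image_eqI[of _ _ 0])
    have "scale k ` (x +o B) = scale k x +o scale k ` B"
      by (force simp: elt_set_plus_def scale_right_distrib)
    then show ?thesis by (simp add: set_plus_rearrange3 sub)
  qed
  \<comment> \<open>The summand \<open>B\<close> is kept throughout the induction, so that the empty
    sum gives the zero coset; as \<open>B + B = B\<close>, each step may use a further copy of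
    it.\<close>
  have "(\<Sum>i<n. scale (as ! i) ` (hs ! i)) + B = (\<Sum>i<n. scale (as ! i) (ls ! i)) +o B"
    if "n \<le> length hs" for n
    using that
  proof (induction n)
    case (Suc n)
    have "(\<Sum>i<Suc n. scale (as ! i) ` (hs ! i)) + B
        = ((\<Sum>i<n. scale (as ! i) ` (hs ! i)) + B) + (scale (as ! n) ` (hs ! n) + B)"
      by (simp add: add.assoc add.left_commute[of B] BB)
    also have "\<dots> = ((\<Sum>i<n. scale (as ! i) (ls ! i)) +o B) + (scale (as ! n) (ls ! n) +o B)"
      using Suc by (simp add: nth coset)
    finally show ?case by (simp add: set_plus_rearrange BB)
  qed simp
  then show ?thesis by (simp add: quot_lincomb_def list_lincomb_def len)
qed

lemma coset_eq_iff:
  assumes "subspace B"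
  shows "x +o B = y +o B \<longleftrightarrow> x - y \<in> B"
proof
  assume "x +o B = y +o B"
  then have "x \<in> y +o B" using subspace_0[OF assms] by (force simp: elt_set_plus_def)
  then show "x - y \<in> B" by (simp add: set_plus_imp_minus)
next
  assume xy: "x - y \<in> B"
  have sub: "u +o B \<subseteq> v +o B" if "u - v \<in> B" for u v
  proof
    fix w assume "w \<in> u +o B"
    then have "w - u \<in> B" by (rule set_plus_imp_minus)
    then have "(w - u) + (u - v) \<in> B" using that by (rule subspace_add[OF assms])
    then show "w \<in> v +o B" by (intro set_minus_imp_plus) simp
  qed
  from xy have "y - x \<in> B" using subspace_neg[OF assms xy] by simp
  with xy sub show "x +o B = y +o B" by blast
qed

lemma mem_quot_space:
  assumes "subspace B" "A \<in> quot_space Z B" "x \<in> A"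
  shows "A = x +o B"
proof -
  obtain z where z: "A = z +o B" using assms(2) by (auto simp: quot_space_def)
  have "x - z \<in> B" using assms(3) z by (simp add: set_plus_imp_minus)
  then show ?thesis using coset_eq_iff[OF assms(1), of x z] z by simp
qed

lemma quot_representatives_subset:
  assumes "subspace Z" "B \<subseteq> Z" "quot_ordered_basis Z B hs" "list_all2 (\<in>) ls hs"
  shows "set ls \<subseteq> Z"
proof
  fix x assume "x \<in> set ls"
  then obtain A where A: "A \<in> set hs" "x \<in> A"
    using assms(4) by (metis in_set_conv_nth list_all2_conv_all_nth)
  then obtain z where "z \<in> Z" "A = z +o B"
    using assms(3) by (auto simp: quot_ordered_basis_def quot_space_def)
  with A assms(1,2) show "x \<in> Z"
    by (auto simp: elt_set_plus_def intro: subspace_add)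
qed

text \<open>The exact sequence from \<open>B\<close> through \<open>Z\<close> to the quotient: the
  coset of \<open>z\<close> determines the coefficients of the representatives, and what remains of
  \<open>z\<close> lies in \<open>B\<close>.\<close>

lemma ordered_basis_append_representatives:
  assumes Z: "subspace Z" and BZ: "B \<subseteq> Z" and bs: "ordered_basis B bs"
    and hs: "quot_ordered_basis Z B hs" and ls: "list_all2 (\<in>) ls hs"
  shows "ordered_basis Z (bs @ ls)"
proof -
  note B = ordered_basis_subspace[OF bs]
  have len: "length ls = length hs" using ls by (simp add: list_all2_lengthD)
  have reps: "list_all2 (\<lambda>x A. A = x +o B) ls hs"
    unfolding list_all2_conv_all_nth
  proof (intro conjI allI impI)
    fix i assume "i < length ls"
    then have "hs ! i \<in> quot_space Z B" "ls ! i \<in> hs ! i"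
      using hs ls len nth_mem by (auto simp: quot_ordered_basis_def list_all2_conv_all_nth)
    then show "hs ! i = ls ! i +o B" by (rule mem_quot_space[OF B])
  qed (rule len)
  have lsZ: "set ls \<subseteq> Z" by (rule quot_representatives_subset[OF Z BZ hs ls])
  have uniq: "\<exists>!as. length as = length hs \<and> list_lincomb ((!) as) ls +o B = z +o B" if "z \<in> Z" for z
    using hs that unfolding quot_ordered_basis_def quot_space_def
    by (simp add: quot_lincomb_representatives[OF B reps])
  \<comment> \<open>Coordinates in the quotient are unique as lists of the right length, so
    coefficient functions are cut down to such lists.\<close>
  have list_of: "list_lincomb ((!) (map a [0..<length hs])) ls = list_lincomb a ls" for a
    by (rule list_lincomb_cong) (simp add: len)
  show ?thesis
    unfolding ordered_basis_iff
  proof (intro conjI allI impI)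
    fix a i assume 0: "list_lincomb a (bs @ ls) = 0" and i: "i < length (bs @ ls)"
    define a' where "a' j = a (length bs + j)" for j
    have eq: "list_lincomb a bs + list_lincomb a' ls = 0"
      using 0 unfolding list_lincomb_append a'_def .
    then have "list_lincomb a' ls = - list_lincomb a bs" by (simp add: eq_neg_iff_add_eq_0 add.commute)
    then have "list_lincomb a' ls \<in> B"
      using list_lincomb_in[OF B ordered_basis_subset[OF bs]] by (simp add: subspace_neg[OF B])
    then have 1: "list_lincomb a' ls +o B = 0 +o B" using coset_eq_iff[OF B, of _ 0] by simp
    have "list_lincomb ((!) (replicate (length hs) 0)) ls = 0"
      by (rule list_lincomb_zero) (simp add: len)
    \<comment> \<open>Both coefficient lists represent the zero coset, hence they coincide.\<close>
    with 1 have "map a' [0..<length hs] = replicate (length hs) 0"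
      using uniq[OF subspace_0[OF Z]] list_of[of a'] by (metis length_map length_replicate length_upt minus_nat.diff_0)
    then have h: "a' j = 0" if "j < length hs" for j
      using that by (metis add_0 diff_zero length_upt nth_map nth_replicate nth_upt)
    then have "list_lincomb a' ls = 0" by (intro list_lincomb_zero) (simp add: len)
    with eq have "list_lincomb a bs = 0" by simp
    then have b: "a j = 0" if "j < length bs" for j
      using ordered_basis_independent[OF bs] that by blast
    show "a i = 0" using h[of "i - length bs"] b[of i] i len
      by (cases "i < length bs") (auto simp: a'_def)
  next
    have sub: "set (bs @ ls) \<subseteq> Z" using ordered_basis_subset[OF bs] BZ lsZ by auto
    show "Z = range (\<lambda>a. list_lincomb a (bs @ ls))"
    proof
      show "range (\<lambda>a. list_lincomb a (bs @ ls)) \<subseteq> Z" using list_lincomb_in[OF Z sub] by auto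
      show "Z \<subseteq> range (\<lambda>a. list_lincomb a (bs @ ls))"
      proof
        fix z assume "z \<in> Z"
        then obtain as where "list_lincomb ((!) as) ls +o B = z +o B" using uniq by blast
        then have "z - list_lincomb ((!) as) ls \<in> B" using coset_eq_iff[OF B] by metis
        then obtain b where "z - list_lincomb ((!) as) ls = list_lincomb b bs"
          using ordered_basis_expand[OF bs] by blast
        then have "z = list_lincomb b bs + list_lincomb ((!) as) ls" by (simp add: algebra_simps)
        then show "z \<in> range (\<lambda>a. list_lincomb a (bs @ ls))"
          using list_lincomb_append_if[of bs b "(!) as" ls] by (metis rangeI)
      qed
    qed
  qed
qed

lemma quot_representatives_exist:
  assumes "subspace B" "quot_ordered_basis Z B hs"
  shows "\<exists>ls. list_all2 (\<in>) ls hs"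
proof -
  have "(SOME x. x \<in> A) \<in> A" if A: "A \<in> set hs" for A
  proof -
    obtain z where "A = z +o B"
      using A assms(2) by (auto simp: quot_ordered_basis_def quot_space_def)
    then have "z + 0 \<in> A" using subspace_0[OF assms(1)] by blast
    then show ?thesis by (rule someI)
  qed
  then have "list_all2 (\<in>) (map (\<lambda>A. SOME x. x \<in> A) hs) hs"
    by (simp add: list_all2_conv_all_nth)
  then show ?thesis ..
qed

text \<open>Completing a basis of \<open>B\<close> by representatives gives a basis of
  \<open>Z\<close>, so every basis of the quotient has length \<open>dim Z - dim B\<close> and the
  description defining \<open>quot_dim\<close> is unique.\<close>

lemma quot_dim_eq_length:
  assumes Z: "subspace Z" "B \<subseteq> Z" and bs: "ordered_basis B bs" and hs: "quot_ordered_basis Z B hs"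
  shows "quot_dim Z B = length hs"
proof -
  have len: "length gs = dim Z - dim B" if gs: "quot_ordered_basis Z B gs" for gs
  proof -
    obtain ls where ls: "list_all2 (\<in>) ls gs"
      using quot_representatives_exist[OF ordered_basis_subspace[OF bs] gs] by blast
    from ordered_basis_length[OF ordered_basis_append_representatives[OF Z bs gs ls]] show ?thesis
      using ls ordered_basis_length[OF bs] by (simp add: list_all2_lengthD)
  qed
  show ?thesis
    unfolding quot_dim_def using hs len by (intro the_equality) auto
qed

end


subsection \<open>Gram determinants and alternating forms\<close>

definition gram_det :: "('b \<Rightarrow> 'b \<Rightarrow> 'a::comm_ring_1) \<Rightarrow> 'b list \<Rightarrow> 'b list \<Rightarrow> 'a" where
  "gram_det P xs ys = det (mat (length xs) (length xs) (\<lambda>(i, j). P (xs ! i) (ys ! j)))"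

lemma gram_det_Nil [simp]: "gram_det P [] ys = 1"
  by (simp add: gram_det_def)

lemma gram_det_flip:
  assumes "length xs = length ys"
  shows "gram_det P xs ys = gram_det (\<lambda>x y. P y x) ys xs"
proof -
  have "mat (length ys) (length ys) (\<lambda>(i, j). P (xs ! j) (ys ! i)) =
      transpose_mat (mat (length xs) (length xs) (\<lambda>(i, j). P (xs ! i) (ys ! j)))"
    by (intro eq_matI) (auto simp: assms)
  then show ?thesis
    unfolding gram_det_def by (simp add: det_transpose[of _ "length xs"])
qed

lemma gram_det_identity:
  assumes "\<And>i j. i < length xs \<Longrightarrow> j < length xs \<Longrightarrow> P (xs ! i) (ys ! j) = (if i = j then 1 else 0)"
  shows "gram_det P xs ys = 1"
proof -
  have "mat (length xs) (length xs) (\<lambda>(i, j). P (xs ! i) (ys ! j)) = 1\<^sub>m (length xs)"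
    by (intro eq_matI) (auto simp: assms)
  then show ?thesis by (simp add: gram_det_def)
qed

lemma gram_det_cong:
  assumes "length xs = length xs'"
    and "\<And>i j. i < length xs \<Longrightarrow> j < length xs \<Longrightarrow> P (xs ! i) (ys ! j) = Q (xs' ! i) (ys' ! j)"
  shows "gram_det P xs ys = gram_det Q xs' ys'"
proof -
  have "mat (length xs) (length xs) (\<lambda>(i, j). P (xs ! i) (ys ! j)) =
      mat (length xs') (length xs') (\<lambda>(i, j). Q (xs' ! i) (ys' ! j))"
    using assms by (intro eq_matI) auto
  then show ?thesis by (simp add: gram_det_def)
qed

text \<open>Orthogonality of \<open>xs1\<close> and \<open>ys2\<close> makes the upper right block
  of the Gram matrix zero.\<close>

lemma gram_det_append_triangular:
  fixes P :: "'b \<Rightarrow> 'b \<Rightarrow> 'a::idom"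
  assumes "length xs1 = length ys1" "length xs2 = length ys2"
    and 0: "\<And>x y. x \<in> set xs1 \<Longrightarrow> y \<in> set ys2 \<Longrightarrow> P x y = 0"
  shows "gram_det P (xs1 @ xs2) (ys1 @ ys2) = gram_det P xs1 ys1 * gram_det P xs2 ys2"
proof -
  let ?n = "length xs1" and ?m = "length xs2"
  let ?A = "mat ?n ?n (\<lambda>(i, j). P (xs1 ! i) (ys1 ! j))"
    and ?B = "mat ?m ?n (\<lambda>(i, j). P (xs2 ! i) (ys1 ! j))"
    and ?D = "mat ?m ?m (\<lambda>(i, j). P (xs2 ! i) (ys2 ! j))"
  have "mat (?n + ?m) (?n + ?m) (\<lambda>(i, j). P ((xs1 @ xs2) ! i) ((ys1 @ ys2) ! j)) =
      four_block_mat ?A (0\<^sub>m ?n ?m) ?B ?D"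
    using assms(1,2) by (intro eq_matI) (auto simp: nth_append intro!: 0)
  moreover have "det (four_block_mat ?A (0\<^sub>m ?n ?m) ?B ?D) = det ?A * det ?D"
    by (rule det_four_block_mat_upper_right_zero) auto
  ultimately show ?thesis by (simp add: gram_det_def)
qed

text \<open>Laplace expansion along row \<open>i\<close>. The weights \<open>K j\<close> are
  cofactors and do not depend on \<open>x\<close>, which makes the determinant linear in the
  \<open>i\<close>-th vector.\<close>

lemma gram_det_row_expansion:
  assumes "length xs = n" "i < n"
  shows "\<exists>K. \<forall>x. gram_det P (xs[i := x]) ys = (\<Sum>j<n. P x (ys ! j) * K j)"
proof -
  define A where "A x = mat n n (\<lambda>(r, s). P (xs[i := x] ! r) (ys ! s))" for x
  \<comment> \<open>Only row \<open>i\<close> depends on \<open>x\<close>, and the minor deletes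
    it.\<close>
  have cof: "cofactor (A x) i j = cofactor (A (xs ! i)) i j" if "j < n" for x j
  proof -
    have "mat_delete (A x) i j = mat_delete (A (xs ! i)) i j"
      unfolding mat_delete_def using that assms by (intro eq_matI) (auto simp: A_def nth_list_update)
    then show ?thesis by (simp add: cofactor_def)
  qed
  have "gram_det P (xs[i := x]) ys = (\<Sum>j<n. P x (ys ! j) * cofactor (A (xs ! i)) i j)" for x
  proof -
    have "gram_det P (xs[i := x]) ys = det (A x)" using assms by (simp add: gram_det_def A_def)
    also have "\<dots> = (\<Sum>j<n. A x $$ (i, j) * cofactor (A x) i j)"
      by (rule laplace_expansion_row) (use assms in \<open>auto simp: A_def\<close>)
    also have "\<dots> = (\<Sum>j<n. P x (ys ! j) * cofactor (A (xs ! i)) i j)"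
    proof (rule sum.cong[OF refl])
      fix j assume "j \<in> {..<n}"
      then have j: "j < n" by simp
      have "A x $$ (i, j) = P x (ys ! j)" using assms j by (simp add: A_def)
      then show "A x $$ (i, j) * cofactor (A x) i j = P x (ys ! j) * cofactor (A (xs ! i)) i j"
        unfolding cof[OF j, of x] by simp
    qed
    finally show ?thesis .
  qed
  then show ?thesis by blast
qed

section \<open>Alternating forms of top degree and the ratio of two bases\<close>

context vec_space_over
begin

lemma alternating_form_add:
  "alternating_form V n \<omega> \<Longrightarrow> length xs = n \<Longrightarrow> set xs \<subseteq> V \<Longrightarrow> i < n \<Longrightarrow> x \<in> V \<Longrightarrow> y \<in> V \<Longrightarrow>
     \<omega> (xs[i := x + y]) = \<omega> (xs[i := x]) + \<omega> (xs[i := y])"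
  unfolding alternating_form_def by blast

lemma alternating_form_scale:
  "alternating_form V n \<omega> \<Longrightarrow> length xs = n \<Longrightarrow> set xs \<subseteq> V \<Longrightarrow> i < n \<Longrightarrow> x \<in> V \<Longrightarrow>
     \<omega> (xs[i := scale a x]) = a * \<omega> (xs[i := x])"
  unfolding alternating_form_def by blast

lemma alternating_form_eq_entries:
  "alternating_form V n \<omega> \<Longrightarrow> length xs = n \<Longrightarrow> set xs \<subseteq> V \<Longrightarrow> i < n \<Longrightarrow> j < n \<Longrightarrow> i \<noteq> j \<Longrightarrow>
     xs ! i = xs ! j \<Longrightarrow> \<omega> xs = 0"
  unfolding alternating_form_def by blast

text \<open>Polarisation: the form vanishes with \<open>x + y\<close> in both slots, and expanding
  leaves the two mixed terms, whose sum is therefore zero.\<close>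

lemma alternating_form_swap:
  assumes \<omega>: "alternating_form V n \<omega>" and V: "subspace V"
    and xs: "length xs = n" "set xs \<subseteq> V" and ij: "i < n" "j < n" "i \<noteq> j"
  shows "\<omega> (xs[i := xs ! j, j := xs ! i]) = - \<omega> xs"
proof -
  define x y where "x = xs ! i" and "y = xs ! j"
  have x: "x \<in> V" and y: "y \<in> V"
    using xs ij nth_mem[of i xs] nth_mem[of j xs] by (auto simp: x_def y_def)
  then have xy: "x + y \<in> V" by (rule subspace_add[OF V])
  define F where "F a b = \<omega> (xs[i := a, j := b])" for a b
  have F0: "F a a = 0" if "a \<in> V" for a
    unfolding F_def
    by (rule alternating_form_eq_entries[OF \<omega> _ _ ij]) (use xs ij that in \<open>simp_all add: set_update_subsetI\<close>)
  have add2: "F a (b + c) = F a b + F a c" if "a \<in> V" "b \<in> V" "c \<in> V" for a b c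
    unfolding F_def
    by (rule alternating_form_add[OF \<omega>]) (use xs ij that in \<open>simp_all add: set_update_subsetI\<close>)
  have add1: "F (b + c) a = F b a + F c a" if "a \<in> V" "b \<in> V" "c \<in> V" for a b c
    unfolding F_def list_update_swap[OF ij(3)]
    by (rule alternating_form_add[OF \<omega>]) (use xs ij that in \<open>simp_all add: set_update_subsetI\<close>)
  have "F (x + y) (x + y) = F x x + F y x + (F x y + F y y)"
    unfolding add2[OF xy x y] add1[OF x x y] add1[OF y x y] ..
  then have "F y x = - F x y" by (simp add: F0 x y xy eq_neg_iff_add_eq_0)
  then show ?thesis by (simp add: F_def x_def y_def)
qed

text \<open>Each vector of \<open>xs\<close> passes each vector of \<open>ys\<close> once, and every
  such passage is one transposition of neighbours.\<close>

lemma alternating_form_swap_blocks: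
  assumes \<omega>: "alternating_form V n \<omega>" and V: "subspace V"
    and "length (us @ xs @ ys @ vs) = n" "set (us @ xs @ ys @ vs) \<subseteq> V"
  shows "\<omega> (us @ xs @ ys @ vs) = (-1) ^ (length xs * length ys) * \<omega> (us @ ys @ xs @ vs)"
  using assms(3,4)
proof (induction xs arbitrary: us)
  case (Cons x xs)
  have single: "\<omega> (us @ x # ys @ zs) = (-1) ^ length ys * \<omega> (us @ ys @ x # zs)"
    if "length (us @ x # ys @ zs) = n" "set (us @ x # ys @ zs) \<subseteq> V" for us ys zs
    using that
  proof (induction ys arbitrary: us)
    case (Cons y ys)
    have "\<omega> (us @ x # y # ys @ zs) = - \<omega> (us @ y # x # ys @ zs)"
      using alternating_form_swap[OF \<omega> V, of "us @ y # x # ys @ zs" "length us" "Suc (length us)"]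
        Cons.prems
      by (simp add: nth_append list_update_append)
    also have "\<omega> (us @ y # x # ys @ zs) = (-1) ^ length ys * \<omega> (us @ y # ys @ x # zs)"
      using Cons.IH[of "us @ [y]"] Cons.prems by simp
    finally show ?case by simp
  qed simp
  have "\<omega> (us @ (x # xs) @ ys @ vs) = (-1) ^ (length xs * length ys) * \<omega> (us @ x # ys @ xs @ vs)"
    using Cons.IH[of "us @ [x]"] Cons.prems by simp
  also have "\<omega> (us @ x # ys @ xs @ vs) = (-1) ^ length ys * \<omega> (us @ ys @ x # xs @ vs)"
    by (rule single) (use Cons.prems in auto)
  finally show ?case by (simp add: power_add mult_ac)
qed simp

lemma permute_list_transpose:
  assumes "a < length xs" "b < length xs"
  shows "permute_list (Transposition.transpose a b) xs = xs[a := xs ! b, b := xs ! a]"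
  using assms
  by (intro nth_equalityI)
    (auto simp: permute_list_nth permutes_swap_id Transposition.transpose_def nth_list_update)

text \<open>A permutation is a product of transpositions, and each of them only changes the sign of
  the value.\<close>

lemma alternating_form_permute_zero:
  assumes \<omega>: "alternating_form V n \<omega>" and V: "subspace V" and p: "p permutes {..<n}"
    and "length xs = n" "set xs \<subseteq> V" "\<omega> xs = 0"
  shows "\<omega> (permute_list p xs) = 0"
  using p finite_lessThan assms(4-)
proof (induction p arbitrary: xs rule: permutes_induct)
  case (swap a b p)
  let ?ys = "permute_list (Transposition.transpose a b) xs"
  have ys: "?ys = xs[a := xs ! b, b := xs ! a]"
    using swap by (intro permute_list_transpose) auto
  have "permute_list (Transposition.transpose a b \<circ> p) xs = permute_list p ?ys"
    using swap by (intro permute_list_compose) auto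
  moreover have "\<omega> ?ys = 0"
    unfolding ys using alternating_form_swap[OF \<omega> V, of xs a b] swap by simp
  moreover have "set ?ys \<subseteq> V"
    using swap by (simp add: permutes_swap_id)
  ultimately show ?case using swap.IH[of ?ys] swap.prems by (metis length_permute_list)
qed simp

text \<open>By multilinearity it is enough to treat lists with entries from \<open>bs\<close>. Such
  a list either repeats an entry or is a permutation of \<open>bs\<close>.\<close>

lemma alternating_form_eq_zero:
  assumes \<omega>: "alternating_form V n \<omega>"
    and bs: "span (set bs) = V" "length bs = n" "\<omega> bs = 0"
    and xs: "length xs = n" "set xs \<subseteq> V"
  shows "\<omega> xs = 0"
proof -
  have V: "subspace V" and bsV: "set bs \<subseteq> V" using bs(1) span_superset by auto
  have base: "\<omega> xs = 0" if len: "length xs = n" and sub: "set xs \<subseteq> set bs" for xs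
  proof (cases "distinct xs")
    case True
    then have "card (set xs) = length bs" using len bs(2) by (simp add: distinct_card)
    moreover have "card (set xs) \<le> card (set bs)" using sub by (simp add: card_mono)
    \<comment> \<open>Pigeonhole: \<open>n\<close> distinct entries taken from the at most
      \<open>n\<close> elements of \<open>bs\<close> exhaust them, so \<open>bs\<close> is distinct
      as well.\<close>
    ultimately have "card (set bs) = length bs" "card (set xs) = card (set bs)"
      using card_length[of bs] by auto
    then have "distinct bs" "set xs = set bs"
      using card_distinct sub by (auto simp: card_subset_eq)
    with True have "mset xs = mset bs" by (simp add: set_eq_iff_mset_eq_distinct)
    then obtain p where "p permutes {..<length bs}" "permute_list p bs = xs"
      by (rule mset_eq_permutation)
    with alternating_form_permute_zero[OF \<omega> V, of p bs] show ?thesis using bs bsV by simp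
  next
    case False
    then obtain i j where "i < n" "j < n" "i \<noteq> j" "xs ! i = xs ! j"
      using len by (auto simp: distinct_conv_nth)
    with alternating_form_eq_entries[OF \<omega> len] show ?thesis using sub bsV by auto
  qed
  \<comment> \<open>Induction on the number \<open>k\<close> of leading entries that may be
    arbitrary vectors of \<open>V\<close>; the remaining ones come from \<open>bs\<close>.\<close>
  have "\<omega> xs = 0"
    if "k \<le> n" "length xs = n" "set xs \<subseteq> V" "\<And>i. k \<le> i \<Longrightarrow> i < n \<Longrightarrow> xs ! i \<in> set bs" for k xs
    using that
  proof (induction k arbitrary: xs)
    case 0
    then show ?case by (intro base) (auto simp: in_set_conv_nth)
  next
    case (Suc k)
    \<comment> \<open>Linearity in slot \<open>k\<close> makes this a subspace. By the induction
      hypothesis it contains \<open>bs\<close>, hence it is all of \<open>V\<close>.\<close>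
    let ?W = "{v \<in> V. \<omega> (xs[k := v]) = 0}"
    have kn: "k < n" using Suc.prems by simp
    have "subspace ?W"
      using alternating_form_scale[OF \<omega> Suc.prems(2,3) kn, of 0 0]
        alternating_form_add[OF \<omega> Suc.prems(2,3) kn]
        alternating_form_scale[OF \<omega> Suc.prems(2,3) kn]
      by (simp add: subspace_def subspace_0[OF V] subspace_add[OF V] subspace_scale[OF V])
    moreover have "set bs \<subseteq> ?W"
    proof
      fix b assume b: "b \<in> set bs"
      have "\<omega> (xs[k := b]) = 0"
      proof (rule Suc.IH)
        show "set (xs[k := b]) \<subseteq> V" using Suc.prems(3) b bsV by (intro set_update_subsetI) auto
        show "xs[k := b] ! i \<in> set bs" if "k \<le> i" "i < n" for i
          using that b Suc.prems(2,4) by (cases "i = k") auto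
      qed (use Suc.prems in auto)
      with b bsV show "b \<in> ?W" by auto
    qed
    ultimately have "V \<subseteq> ?W" using span_minimal[of "set bs" ?W] bs(1) by simp
    moreover have "xs ! k \<in> V" using Suc.prems(2,3) kn nth_mem[of k xs] by blast
    ultimately have "\<omega> (xs[k := xs ! k]) = 0" by blast
    then show ?case by simp
  qed
  from this[of n] show ?thesis using xs by simp
qed

lemma alternating_form_diff_scaled:
  assumes "alternating_form V n \<omega>" "alternating_form V n \<eta>"
  shows "alternating_form V n (\<lambda>xs. \<eta> xs - k * \<omega> xs)"
  unfolding alternating_form_def
proof (intro allI impI conjI ballI)
  fix xs i assume xs: "length xs = n \<and> set xs \<subseteq> V" and i: "i < n"
  note add = assms[THEN alternating_form_add, of xs i] and scale = assms[THEN alternating_form_scale, of xs i]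
    and eq = assms[THEN alternating_form_eq_entries, of xs i]
  show "\<eta> (xs[i := x + y]) - k * \<omega> (xs[i := x + y]) =
      \<eta> (xs[i := x]) - k * \<omega> (xs[i := x]) + (\<eta> (xs[i := y]) - k * \<omega> (xs[i := y]))"
    if "x \<in> V" "y \<in> V" for x y
    using add[of x y] xs i that by (simp add: algebra_simps)
  show "\<eta> (xs[i := scale a x]) - k * \<omega> (xs[i := scale a x]) =
      a * (\<eta> (xs[i := x]) - k * \<omega> (xs[i := x]))" if "x \<in> V" for x a
    using scale[of x a] xs i that by (simp add: algebra_simps)
  show "\<eta> xs - k * \<omega> xs = 0" if "j < n" "i \<noteq> j \<and> xs ! i = xs ! j" for j
    using eq[of j] xs i that by simp
qed

text \<open>The space of top forms is at most one-dimensional: subtracting from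
  \<open>\<eta>\<close> the multiple of \<open>\<omega>\<close> that agrees with it on
  \<open>bs\<close> leaves a form vanishing on \<open>bs\<close>, hence zero. The identity is
  cross-multiplied to cover \<open>\<omega> bs = 0\<close> too.\<close>

lemma alternating_forms_proportional:
  assumes \<omega>: "alternating_form V n \<omega>" and \<eta>: "alternating_form V n \<eta>"
    and bs: "span (set bs) = V" "length bs = n"
    and xs: "length xs = n" "set xs \<subseteq> V"
  shows "\<eta> xs * \<omega> bs = \<eta> bs * \<omega> xs"
proof (cases "\<omega> bs = 0")
  case True
  then show ?thesis using alternating_form_eq_zero[OF \<omega> bs _ xs] by simp
next
  case False
  have "\<eta> xs - \<eta> bs / \<omega> bs * \<omega> xs = 0"
    by (rule alternating_form_eq_zero[OF alternating_form_diff_scaled[OF \<omega> \<eta>] bs _ xs])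
      (use False in simp)
  then show ?thesis using False by (simp add: field_simps)
qed

text \<open>Proportionality of top forms lets one form that is nonzero on \<open>xs\<close> compute
  the ratio for all forms; evaluating at this form also pins down the scalar.\<close>

lemma basis_ratio_eq:
  assumes \<omega>: "alternating_form V n \<omega>" "\<omega> xs \<noteq> 0"
    and xs: "span (set xs) = V" "length xs = n" and ys: "length ys = n" "set ys \<subseteq> V"
  shows "basis_ratio V ys xs = \<omega> ys / \<omega> xs"
  unfolding basis_ratio_def
proof (rule the_equality)
  show "wedge V ys = (\<lambda>\<eta>. \<omega> ys / \<omega> xs * wedge V xs \<eta>)"
    using alternating_forms_proportional[OF \<omega>(1) _ xs ys] \<omega>(2) xs ys
    by (auto simp: wedge_def fun_eq_iff field_simps)
next
  fix k assume "wedge V ys = (\<lambda>\<eta>. k * wedge V xs \<eta>)"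
  then have "wedge V ys \<omega> = k * wedge V xs \<omega>" by (rule fun_cong)
  then show "k = \<omega> ys / \<omega> xs" using \<omega> xs ys by (simp add: wedge_def)
qed

lemma alternating_form_gram_det:
  assumes P: "bilinear_pairing V P" and ys: "length ys = n" "set ys \<subseteq> V"
  shows "alternating_form V n (\<lambda>xs. gram_det P xs ys)"
  unfolding alternating_form_def
proof (intro allI impI conjI ballI)
  have ysV: "ys ! j \<in> V" if "j < n" for j using ys that nth_mem[of j ys] by auto
  fix xs :: "'b list" and i assume xs: "length xs = n \<and> set xs \<subseteq> V" and i: "i < n"
  obtain K where K: "\<And>x. gram_det P (xs[i := x]) ys = (\<Sum>j<n. P x (ys ! j) * K j)"
    using gram_det_row_expansion[of xs n i P ys] xs i by blast
  show "gram_det P (xs[i := x + y]) ys = gram_det P (xs[i := x]) ys + gram_det P (xs[i := y]) ys"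
    if "x \<in> V" "y \<in> V" for x y
    unfolding K using P that ysV
    by (simp add: bilinear_pairing_def sum.distrib[symmetric] distrib_right)
  show "gram_det P (xs[i := scale a x]) ys = a * gram_det P (xs[i := x]) ys"
    if "x \<in> V" for x a
    unfolding K using P that ysV
    by (simp add: bilinear_pairing_def sum_distrib_left mult.assoc)
  fix j assume j: "j < n" and ij: "i \<noteq> j \<and> xs ! i = xs ! j"
  show "gram_det P xs ys = 0"
    unfolding gram_det_def
    by (rule det_identical_rows[where i = i and j = j and n = n]) (use xs i j ij in \<open>auto simp: row_def\<close>)
qed

lemma bilinear_pairing_flip: "bilinear_pairing V P \<Longrightarrow> bilinear_pairing V (\<lambda>x y. P y x)"
  by (auto simp: bilinear_pairing_def)

end


subsection \<open>Bases adapted to a differential\<close>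

text \<open>The degree \<open>e\<close> is a parameter so that \<open>d\<close> with
  \<open>e = 1\<close> and \<open>ds\<close> with \<open>e = -1\<close> are treated
  together.\<close>

locale graded_complex = vec_space_over scale
  for scale :: "'a::field \<Rightarrow> 'b::ab_group_add \<Rightarrow> 'b" +
  fixes C :: "int \<Rightarrow> 'b set" and \<delta> :: "'b \<Rightarrow> 'b" and e :: int
  assumes subspace_component: "subspace (C q)"
    and finite_dim_component: "\<exists>S. finite S \<and> span S = C q"
    and linear_\<delta>: "Vector_Spaces.linear scale scale \<delta>"
    and \<delta>_degree: "x \<in> C q \<Longrightarrow> \<delta> x \<in> C (q + e)"
    and \<delta>_\<delta>: "x \<in> C q \<Longrightarrow> \<delta> (\<delta> x) = 0"
begin

sublocale \<delta>: Vector_Spaces.linear scale scale \<delta>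
  by (rule linear_\<delta>)

lemma subspace_cycles: "subspace (cycles C \<delta> q)"
  using subspace_component[of q]
  by (auto simp: cycles_def subspace_def \<delta>.add \<delta>.scale \<delta>.zero)

lemma boundaries_subset_cycles: "boundaries C \<delta> e q \<subseteq> cycles C \<delta> q"
  using \<delta>_degree[of _ "q - e"] \<delta>_\<delta>[of _ "q - e"] by (auto simp: boundaries_def cycles_def)

lemma boundaries_basis_exists: "\<exists>xs. ordered_basis (boundaries C \<delta> e q) xs"
proof -
  obtain S where S: "finite S" "span S = C (q - e)" using finite_dim_component by blast
  then have "span (\<delta> ` S) = boundaries C \<delta> e q"
    by (simp add: \<delta>.span_image boundaries_def)
  with S(1) show ?thesis by (intro ordered_basis_exists[of "\<delta> ` S"]) auto
qed

lemma homology_dim_eq_length: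
  assumes "homology_basis C \<delta> e q hs"
  shows "homology_dim C \<delta> e q = length hs"
  using assms quot_dim_eq_length[OF subspace_cycles boundaries_subset_cycles] boundaries_basis_exists
  unfolding homology_basis_def homology_dim_def by blast

text \<open>Supplies the existence half of the definite descriptions in \<open>tau\<close> and
  \<open>torsion\<close>.\<close>

lemma auxiliary_choice_exists:
  assumes h: "\<And>q. q \<in> {0..int N} \<Longrightarrow> homology_basis C \<delta> e q (h q)"
  shows "\<exists>b bt lh. auxiliary_choice N C \<delta> e h b bt lh"
proof -
  obtain b where b: "\<And>q. ordered_basis (boundaries C \<delta> e q) (b q)"
    using boundaries_basis_exists by metis
  have lift: "\<exists>ts. set ts \<subseteq> C (q - e) \<and> map \<delta> ts = b q" for q
  proof -
    have "b q \<in> lists (\<delta> ` C (q - e))"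
      using ordered_basis_subset[OF b[of q]] by (auto simp: boundaries_def)
    then show ?thesis unfolding lists_image by auto
  qed
  then obtain bt where bt: "\<And>q. set (bt q) \<subseteq> C (q - e) \<and> map \<delta> (bt q) = b q" by metis
  have "\<exists>ls. q \<in> {0..int N} \<longrightarrow> list_all2 (\<in>) ls (h q)" for q
    using h[of q] quot_representatives_exist[OF ordered_basis_subspace[OF b[of q]]]
    unfolding homology_basis_def by blast
  then obtain lh where lh: "\<And>q. q \<in> {0..int N} \<longrightarrow> list_all2 (\<in>) (lh q) (h q)" by metis
  have "auxiliary_choice N C \<delta> e h b bt lh"
    unfolding auxiliary_choice_def using b bt lh by blast
  then show ?thesis by blast
qed

context
  fixes N h b bt lh
  assumes aux: "auxiliary_choice N C \<delta> e h b bt lh"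
begin

lemma boundary_basis: "ordered_basis (boundaries C \<delta> e q) (b q)"
  using aux by (simp add: auxiliary_choice_def)

lemma boundary_lifts: "set (bt q) \<subseteq> C (q - e)" "map \<delta> (bt q) = b q"
  using aux by (simp_all add: auxiliary_choice_def)

lemma length_boundary_lifts: "length (bt q) = length (b q)"
  using boundary_lifts(2)[of q] by (metis length_map)

lemma length_boundary_basis: "length (b q) = dim (boundaries C \<delta> e q)"
  by (rule ordered_basis_length[OF boundary_basis])

lemma homology_representatives: "q \<in> {0..int N} \<Longrightarrow> list_all2 (\<in>) (lh q) (h q)"
  using aux by (simp add: auxiliary_choice_def)

lemma homology_representatives_cycles:
  "q \<in> {0..int N} \<Longrightarrow> homology_basis C \<delta> e q (h q) \<Longrightarrow> set (lh q) \<subseteq> cycles C \<delta> q"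
  using quot_representatives_subset[OF subspace_cycles boundaries_subset_cycles _ homology_representatives]
  by (simp add: homology_basis_def)

text \<open>Two extensions in a row: boundaries by homology give the cycles, and cycles by lifts of
  the boundaries in degree \<open>q + e\<close> give the whole component.\<close>

lemma auxiliary_basis:
  assumes q: "q \<in> {0..int N}" and h: "homology_basis C \<delta> e q (h q)"
  shows "ordered_basis (C q) (b q @ lh q @ bt (q + e))"
proof -
  have "ordered_basis (cycles C \<delta> q) (b q @ lh q)"
    using h
    by (intro ordered_basis_append_representatives[OF subspace_cycles boundaries_subset_cycles
        boundary_basis _ homology_representatives[OF q]]) (simp add: homology_basis_def)
  moreover have "ordered_basis (\<delta> ` C q) (map \<delta> (bt (q + e)))"
    using boundary_basis[of "q + e"] by (simp add: boundary_lifts boundaries_def)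
  moreover have "set (bt (q + e)) \<subseteq> C q" using boundary_lifts(1)[of "q + e"] by simp
  ultimately show ?thesis
    using ordered_basis_kernel_append_lifts[OF linear_\<delta> subspace_component, of q "b q @ lh q"]
    by (simp add: cycles_def)
qed

end
end

section \<open>Zero spaces and telescoping products\<close>

lemma (in vec_space_over) ordered_basis_zero:
  assumes "ordered_basis V xs" "V \<subseteq> {0}"
  shows "xs = []"
proof (rule ccontr)
  assume "xs \<noteq> []"
  then have "hd xs \<in> set xs" by simp
  with ordered_basis_subset[OF assms(1)] assms(2) have "0 \<in> set xs" by auto
  then show False using dependent_zero assms(1) by (simp add: ordered_basis_def)
qed

text \<open>Each inner \<open>a k\<close> occurs in two neighbouring factors with opposite exponents
  and cancels.\<close>

lemma prod_power_int_telescope: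
  fixes a :: "nat \<Rightarrow> 'a::field"
  assumes "\<And>k. k \<le> m \<Longrightarrow> a k \<noteq> 0"
  shows "(\<Prod>k\<le>m. (a k * a (Suc k)) powi ((-1) ^ k)) = a 0 * a (Suc m) powi ((-1) ^ m)"
  using assms
proof (induction m)
  case (Suc m)
  have "(\<Prod>k\<le>Suc m. (a k * a (Suc k)) powi ((-1) ^ k)) =
      a 0 * a (Suc m) powi ((-1) ^ m) * (a (Suc m) * a (Suc (Suc m))) powi ((-1) ^ Suc m)"
    using Suc by simp
  also have "\<dots> = a 0 * (a (Suc m) powi ((-1) ^ m) * a (Suc m) powi (- ((-1) ^ m))) *
      a (Suc (Suc m)) powi ((-1) ^ Suc m)"
    by (simp add: power_int_mult_distrib)
  also have "a (Suc m) powi ((-1) ^ m) * a (Suc m) powi (- ((-1) ^ m)) = 1"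
    using Suc.prems by (simp add: power_int_minus)
  finally show ?case by simp
qed simp

lemma prod_atLeastAtMost_int_of_nat: "(\<Prod>q\<in>{0..int N}. f q) = (\<Prod>k\<le>N. f (int k))"
proof -
  have "{0..int N} = int ` {..N}"
  proof
    show "{0..int N} \<subseteq> int ` {..N}"
    proof
      fix q assume "q \<in> {0..int N}"
      then show "q \<in> int ` {..N}" by (intro image_eqI[of _ _ "nat q"]) auto
    qed
  qed auto
  then show ?thesis by (simp add: prod.reindex)
qed


subsection \<open>A complex and its dual\<close>

text \<open>The setting of the theorem, over an arbitrary field.\<close>

locale cochain_complex_dual_homology = cochain_complex scale N C d
  for scale :: "'a::field \<Rightarrow> 'b::ab_group_add \<Rightarrow> 'b" and N C d +
  fixes ds :: "'b \<Rightarrow> 'b" and c :: "int \<Rightarrow> 'b list"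
    and h h' :: "int \<Rightarrow> 'b set list" and P :: "'b \<Rightarrow> 'b \<Rightarrow> 'a"
  assumes basis_c: "q \<in> {0..int N} \<Longrightarrow> ordered_basis (C q) (c q)"
    and basis_h: "q \<in> {0..int N} \<Longrightarrow> homology_basis C d 1 q (h q)"
    and bilinear: "q \<in> {0..int N} \<Longrightarrow> bilinear_pairing (C q) P"
    and nondegenerate: "q \<in> {0..int N} \<Longrightarrow> nondegenerate_pairing (C q) P"
    and orthonormal_c: "q \<in> {0..int N} \<Longrightarrow> i < length (c q) \<Longrightarrow> j < length (c q) \<Longrightarrow>
      P (c q ! i) (c q ! j) = (if i = j then 1 else 0)"
    and transpose: "transpose_differential C P d ds"
    and basis_h': "q \<in> {0..int N} \<Longrightarrow> homology_basis C ds (-1) q (h' q)"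
    and length_h': "q \<in> {0..int N} \<Longrightarrow> length (h' q) = length (h q)"
    and dual_h': "q \<in> {0..int N} \<Longrightarrow> i < length (h q) \<Longrightarrow> j < length (h' q) \<Longrightarrow>
      induced_pairing P (h q ! i) (h' q ! j) = (if i = j then 1 else 0)"
begin

lemma zero_mem_C: "0 \<in> C q"
  by (rule subspace_0[OF subspace_C])

lemma pairing_zero:
  assumes "q \<in> {0..int N}" "x \<in> C q"
  shows "P 0 x = 0" "P x 0 = 0"
proof -
  have *: "P (scale 0 0) x = 0 * P 0 x" "P x (scale 0 0) = 0 * P x 0"
    using bilinear[OF assms(1)] assms(2) zero_mem_C[of q] unfolding bilinear_pairing_def by blast+
  show "P 0 x = 0" "P x 0 = 0" using * by simp_all
qed

lemma pairing_diff:
  assumes "q \<in> {0..int N}" "x \<in> C q" "y \<in> C q" "z \<in> C q"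
  shows "P (x - y) z = P x z - P y z" "P z (x - y) = P z x - P z y"
proof -
  have xy: "x - y \<in> C q" using subspace_diff[OF subspace_C] assms by blast
  have "P (x - y + y) z = P (x - y) z + P y z" "P z (x - y + y) = P z (x - y) + P z y"
    using bilinear[OF assms(1)] xy assms unfolding bilinear_pairing_def by blast+
  then show "P (x - y) z = P x z - P y z" "P z (x - y) = P z x - P z y" by simp_all
qed

lemma d_adjoint: "x \<in> C (q - 1) \<Longrightarrow> y \<in> C q \<Longrightarrow> P (d x) y = P x (ds y)"
  using transpose by (simp add: transpose_differential_def)

lemma ds_degree: "y \<in> C q \<Longrightarrow> ds y \<in> C (q - 1)"
  using transpose by (auto simp: transpose_differential_def)

lemma ds_zero: "ds 0 = 0"
proof -
  interpret ds: Vector_Spaces.linear scale scale ds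
    using transpose by (simp add: transpose_differential_def)
  show ?thesis by (rule ds.zero)
qed

lemma d_zero: "d 0 = 0"
proof -
  interpret d: Vector_Spaces.linear scale scale d by (rule linear_d)
  show ?thesis by (rule d.zero)
qed

lemma d_degree': "x \<in> C q \<Longrightarrow> d x \<in> C (q + 1)"
  using d_degree by blast

lemma C_outside_zero: "x \<in> C q \<Longrightarrow> q \<notin> {0..int N} \<Longrightarrow> x = 0"
  using C_outside by blast

text \<open>Moving \<open>ds\<close> twice across the pairing turns it into \<open>d\<close> applied
  twice, which is zero; nondegeneracy concludes.\<close>

lemma ds_ds:
  assumes y: "y \<in> C q"
  shows "ds (ds y) = 0"
\<comment> \<open>The pairing is controlled only in degrees from \<open>0\<close> to
  \<open>N\<close>. If \<open>q\<close> or \<open>q - 2\<close> is outside, the component there is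
  zero.\<close>
proof (cases "q \<in> {0..int N} \<and> q - 2 \<in> {0..int N}")
  case True
  have z: "ds (ds y) \<in> C (q - 2)"
    using ds_degree[OF ds_degree[OF y]] by simp
  have "P x (ds (ds y)) = 0" if x: "x \<in> C (q - 2)" for x
  proof -
    have "P x (ds (ds y)) = P (d x) (ds y)"
      using d_adjoint[of x "q - 1" "ds y"] x ds_degree[OF y] by simp
    also have "\<dots> = P (d (d x)) y"
      using d_adjoint[of "d x" q y] d_degree'[OF x] y by simp
    finally show ?thesis using pairing_zero(1)[OF _ y] True by (simp add: d_d)
  qed
  then show ?thesis
    using nondegenerate[of "q - 2"] True z unfolding nondegenerate_pairing_def by blast
next
  case False
  then show ?thesis
  proof (cases "q \<in> {0..int N}")
    case True
    with False have "q - 2 \<notin> {0..int N}" by blast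
    moreover have "ds (ds y) \<in> C (q - 2)" using ds_degree[OF ds_degree[OF y]] by simp
    ultimately show ?thesis by (rule C_outside_zero[rotated])
  qed (use C_outside_zero[OF y] ds_zero in simp)
qed

sublocale d: graded_complex scale C d 1
  by (intro graded_complex.intro graded_complex_axioms.intro vec_space_over_axioms
      subspace_C finite_dim_C linear_d d_degree' d_d)

sublocale ds: graded_complex scale C ds "-1"
proof (intro graded_complex.intro graded_complex_axioms.intro vec_space_over_axioms
    subspace_C finite_dim_C)
  show "Vector_Spaces.linear scale scale ds"
    using transpose by (simp add: transpose_differential_def)
  show "x \<in> C q \<Longrightarrow> ds x \<in> C (q + - 1)" for x q using ds_degree by simp
  show "x \<in> C q \<Longrightarrow> ds (ds x) = 0" for x q by (rule ds_ds)
qed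

section \<open>Orthogonality relations and the induced pairing on homology\<close>

lemma boundary_cocycle_orthogonal:
  assumes q: "q \<in> {0..int N}" and x: "x \<in> boundaries C d 1 q" and y: "y \<in> cycles C ds q"
  shows "P x y = 0"
proof -
  obtain u where u: "u \<in> C (q - 1)" "x = d u" using x by (auto simp: boundaries_def)
  have yC: "y \<in> C q" "ds y = 0" using y by (auto simp: cycles_def)
  show ?thesis
  \<comment> \<open>At the lower end \<open>u\<close> lies in a zero component, so
    \<open>x = 0\<close>.\<close>
  proof (cases "q - 1 \<in> {0..int N}")
    case True
    then show ?thesis using d_adjoint[OF u(1) yC(1)] yC(2) u pairing_zero(2)[OF True u(1)] by simp
  next
    case False
    then show ?thesis using C_outside_zero[OF u(1) False] u(2) d_zero pairing_zero(1)[OF q yC(1)] by simp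
  qed
qed

lemma cycle_coboundary_orthogonal:
  assumes q: "q \<in> {0..int N}" and x: "x \<in> cycles C d q" and y: "y \<in> boundaries C ds (-1) q"
  shows "P x y = 0"
proof -
  obtain u where u: "u \<in> C (q + 1)" "y = ds u" using y by (auto simp: boundaries_def)
  have xC: "x \<in> C q" "d x = 0" using x by (auto simp: cycles_def)
  show ?thesis
  proof (cases "q + 1 \<in> {0..int N}")
    case True
    then show ?thesis using d_adjoint[of x "q + 1" u] xC u pairing_zero(1)[OF True u(1)] by simp
  next
    case False
    then show ?thesis using C_outside_zero[OF u(1) False] u(2) ds_zero pairing_zero(2)[OF q xC(1)] by simp
  qed
qed

text \<open>The pairing of two classes is well defined: changing a representative by a boundary
  changes the value by a term that vanishes by one of the two orthogonality relations.\<close>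

lemma induced_pairing_eq:
  assumes q: "q \<in> {0..int N}"
    and A: "A \<in> quot_space (cycles C d q) (boundaries C d 1 q)" "x \<in> A"
    and B: "B \<in> quot_space (cycles C ds q) (boundaries C ds (-1) q)" "y \<in> B"
  shows "induced_pairing P A B = P x y"
proof -
  obtain z where z: "z \<in> cycles C d q" "A = z +o boundaries C d 1 q"
    using A by (auto simp: quot_space_def)
  obtain w where w: "w \<in> cycles C ds q" "B = w +o boundaries C ds (-1) q"
    using B by (auto simp: quot_space_def)
  have const: "P u v = P z w" if u: "u \<in> A" and v: "v \<in> B" for u v
  proof -
    have uz: "u - z \<in> boundaries C d 1 q" and vw: "v - w \<in> boundaries C ds (-1) q"
      using set_plus_imp_minus u v z(2) w(2) by blast+
    have "(u - z) + z \<in> cycles C d q"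
      using uz z(1) d.boundaries_subset_cycles subspace_add[OF d.subspace_cycles] by blast
    then have uZ: "u \<in> cycles C d q" by simp
    have "(v - w) + w \<in> cycles C ds q"
      using vw w(1) ds.boundaries_subset_cycles subspace_add[OF ds.subspace_cycles] by blast
    then have inC: "u \<in> C q" "z \<in> C q" "v \<in> C q" "w \<in> C q"
      using uZ z w by (auto simp: cycles_def)
    have "P u v - P u w = 0"
      using cycle_coboundary_orthogonal[OF q uZ vw] pairing_diff(2)[OF q] inC by simp
    moreover have "P u w - P z w = 0"
      using boundary_cocycle_orthogonal[OF q uz w(1)] pairing_diff(1)[OF q] inC by simp
    ultimately show ?thesis by simp
  qed
  show ?thesis
    unfolding induced_pairing_def
  proof (rule the_equality)
    show "\<forall>u\<in>A. \<forall>v\<in>B. P u v = P x y" using const A(2) B(2) by simp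
    show "k = P x y" if "\<forall>u\<in>A. \<forall>v\<in>B. P u v = k" for k using that A(2) B(2) by simp
  qed
qed

text \<open>Pairing with the orthonormal basis \<open>c q\<close> gives a top form with value 1 on
  \<open>c q\<close>, so ratios to \<open>c q\<close> are Gram determinants. The product formula
  compares two proportional forms at \<open>xs\<close> and at \<open>c q\<close>.\<close>

lemma basis_ratio_gram_det:
  assumes q: "q \<in> {0..int N}" and X: "ordered_basis (C q) xs" and Y: "ordered_basis (C q) ys"
  shows "basis_ratio (C q) xs (c q) \<noteq> 0"
    and "basis_ratio (C q) xs ys = basis_ratio (C q) xs (c q) / basis_ratio (C q) ys (c q)"
    and "gram_det P xs ys = basis_ratio (C q) xs (c q) * basis_ratio (C q) ys (c q)"
proof -
  define n where "n = length (c q)"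
  \<comment> \<open>The arguments of \<open>P\<close> are exchanged because the value on
    \<open>c q\<close> of the Gram form against \<open>ys\<close> has \<open>c q\<close> on the left
    and \<open>ys\<close> on the right.\<close>
  let ?E = "\<lambda>zs. gram_det (\<lambda>x y. P y x) zs (c q)"
  note c = ordered_basis_span[OF basis_c[OF q]] ordered_basis_subset[OF basis_c[OF q]]
  have len: "length xs = n" "length ys = n"
    using X Y basis_c[OF q] by (simp_all add: n_def ordered_basis_length)
  have sub: "set xs \<subseteq> C q" "set ys \<subseteq> C q"
    using X Y by (simp_all add: ordered_basis_subset)
  have E: "alternating_form (C q) n ?E"
    using alternating_form_gram_det[OF bilinear_pairing_flip[OF bilinear[OF q]]] c(2) n_def by simp
  have Ec: "?E (c q) = 1"
    by (rule gram_det_identity) (simp add: orthonormal_c[OF q])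
  have ratio: "basis_ratio (C q) zs (c q) = ?E zs" if "length zs = n" "set zs \<subseteq> C q" for zs
    using basis_ratio_eq[OF E _ c(1)] that Ec by (simp add: n_def)
  have nonzero: "?E zs \<noteq> 0" if "ordered_basis (C q) zs" "length zs = n" for zs
  proof
    assume "?E zs = 0"
    then have "?E (c q) = 0"
      using alternating_form_eq_zero[OF E ordered_basis_span[OF that(1)] that(2)] c(2) n_def by simp
    with Ec show False by simp
  qed
  show "basis_ratio (C q) xs (c q) \<noteq> 0" using ratio nonzero X len sub by simp
  show "basis_ratio (C q) xs ys = basis_ratio (C q) xs (c q) / basis_ratio (C q) ys (c q)"
    using basis_ratio_eq[OF E nonzero[OF Y len(2)] ordered_basis_span[OF Y] len(2) len(1) sub(1)]
      ratio len sub by simp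
  let ?F = "\<lambda>zs. gram_det P zs (c q)" and ?G = "\<lambda>zs. gram_det P zs ys"
  have F: "alternating_form (C q) n ?F" and G: "alternating_form (C q) n ?G"
    by (rule alternating_form_gram_det[OF bilinear[OF q]]; use c(2) len sub in \<open>simp add: n_def\<close>)+
  have Fc: "?F (c q) = 1"
    by (rule gram_det_identity) (simp add: orthonormal_c[OF q])
  have "?F xs = basis_ratio (C q) xs (c q)"
    using basis_ratio_eq[OF F _ c(1) _ len(1) sub(1)] Fc by (simp add: n_def)
  moreover have "?G (c q) = basis_ratio (C q) ys (c q)"
    using gram_det_flip[of "c q" ys P] ratio[OF len(2) sub(2)] len by (simp add: n_def)
  moreover have "?G xs * ?F (c q) = ?G (c q) * ?F xs"
    by (rule alternating_forms_proportional[OF F G c(1) _ len(1) sub(1)]) (simp add: n_def)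
  ultimately show "gram_det P xs ys = basis_ratio (C q) xs (c q) * basis_ratio (C q) ys (c q)"
    using Fc by (simp add: mult.commute)
qed

section \<open>Gram determinants of the bases adapted to both differentials\<close>

context
  fixes b bt lh b' bt' lh'
  assumes aux: "auxiliary_choice N C d 1 h b bt lh"
    and aux': "auxiliary_choice N C ds (-1) h' b' bt' lh'"
begin

lemma cochain_adapted_basis: "q \<in> {0..int N} \<Longrightarrow> ordered_basis (C q) (b q @ lh q @ bt (q + 1))"
  by (rule d.auxiliary_basis[OF aux _ basis_h])

lemma dual_adapted_basis: "q \<in> {0..int N} \<Longrightarrow> ordered_basis (C q) (b' q @ lh' q @ bt' (q - 1))"
  using ds.auxiliary_basis[OF aux' _ basis_h'] by simp

lemma length_representatives:
  assumes q: "q \<in> {0..int N}"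
  shows "length (lh q) = length (h q)" "length (lh' q) = length (h q)"
  using d.homology_representatives[OF aux q] ds.homology_representatives[OF aux' q]
    length_h'[OF q] by (simp_all add: list_all2_lengthD)

text \<open>These ends start the comparison of boundary dimensions and make the two end factors of
  the telescoping product trivial.\<close>

lemma boundary_bases_outside:
  shows "b 0 = []" "b' (-1) = []" "b (int N + 1) = []"
proof -
  have z: "C (-1) = {0}" "C (int N + 1) = {0}" by (simp_all add: C_outside)
  have "boundaries C d 1 0 \<subseteq> {0}" using z by (simp add: boundaries_def d_zero)
  then show "b 0 = []" by (rule ordered_basis_zero[OF d.boundary_basis[OF aux]])
  have "boundaries C ds (-1) (-1) \<subseteq> {0}" using z ds_degree[of _ 0] by (auto simp: boundaries_def)
  then show "b' (-1) = []" by (rule ordered_basis_zero[OF ds.boundary_basis[OF aux']])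
  have "boundaries C d 1 (int N + 1) \<subseteq> {0}" using z d_degree'[of _ "int N"] by (auto simp: boundaries_def)
  then show "b (int N + 1) = []" by (rule ordered_basis_zero[OF d.boundary_basis[OF aux]])
qed

text \<open>Induction on the degree: the two adapted bases of the same component have equal length,
  and their homology blocks agree in length.\<close>

lemma length_boundary_bases: "k \<le> Suc N \<Longrightarrow> length (b (int k)) = length (b' (int k - 1))"
proof (induction k)
  case 0
  then show ?case by (simp add: boundary_bases_outside)
next
  case (Suc k)
  let ?q = "int k"
  have q: "?q \<in> {0..int N}" using Suc.prems by simp
  have "length (b ?q @ lh ?q @ bt (?q + 1)) = length (b' ?q @ lh' ?q @ bt' (?q - 1))"
    using ordered_basis_length[OF cochain_adapted_basis[OF q]] ordered_basis_length[OF dual_adapted_basis[OF q]] by simp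
  then have "length (b (?q + 1)) = length (b' ?q)"
    using Suc length_representatives[OF q] d.length_boundary_lifts[OF aux]
      ds.length_boundary_lifts[OF aux'] by simp
  then show ?case by (simp add: add.commute)
qed

text \<open>The index of \<open>bt'\<close> is shifted because lifts along \<open>ds\<close> raise
  the degree by one: both lists lie in \<open>C q\<close>.\<close>

definition boundary_gram :: "int \<Rightarrow> 'a" where
  "boundary_gram q = gram_det P (b q) (bt' (q - 1))"

lemma gram_det_reversed_blocks:
  assumes q: "q \<in> {0..int N}"
  shows "gram_det P (b q @ lh q @ bt (q + 1)) (bt' (q - 1) @ lh' q @ b' q) =
    boundary_gram q * boundary_gram (q + 1)"
proof -
  obtain k where k: "q = int k" "k \<le> N" using q by (metis atLeastAtMost_iff nat_0_le nat_le_iff)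
  have len: "length (b q) = length (bt' (q - 1))" "length (bt (q + 1)) = length (b' q)"
    using length_boundary_bases[of k] length_boundary_bases[of "Suc k"] k
      d.length_boundary_lifts[OF aux, of "q + 1"]
      ds.length_boundary_lifts[OF aux', of "q - 1"]
    by (simp_all add: add.commute)
  have lenh: "length (lh q) = length (lh' q)" using length_representatives[OF q] by simp
  have bsub: "set (b q) \<subseteq> boundaries C d 1 q" "set (b' q) \<subseteq> boundaries C ds (-1) q"
    using ordered_basis_subset[OF d.boundary_basis[OF aux]]
      ordered_basis_subset[OF ds.boundary_basis[OF aux']] by blast+
  have lhsub: "set (lh q) \<subseteq> cycles C d q" "set (lh' q) \<subseteq> cycles C ds q"
    using d.homology_representatives_cycles[OF aux q basis_h[OF q]]
      ds.homology_representatives_cycles[OF aux' q basis_h'[OF q]] by simp_all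
  \<comment> \<open>First zero block: images of \<open>d\<close> are orthogonal to the kernel of
    \<open>ds\<close>, which contains \<open>lh' q\<close> and \<open>b' q\<close>.\<close>
  have "P x y = 0" if "x \<in> set (b q)" "y \<in> set (lh' q @ b' q)" for x y
    using that bsub lhsub ds.boundaries_subset_cycles[of q]
    by (intro boundary_cocycle_orthogonal[OF q]) auto
  then have "gram_det P (b q @ lh q @ bt (q + 1)) (bt' (q - 1) @ lh' q @ b' q) =
      boundary_gram q * gram_det P (lh q @ bt (q + 1)) (lh' q @ b' q)"
    unfolding boundary_gram_def using len lenh by (intro gram_det_append_triangular) auto
  also have "gram_det P (lh q @ bt (q + 1)) (lh' q @ b' q) =
      gram_det P (lh q) (lh' q) * gram_det P (bt (q + 1)) (b' q)"
  proof (rule gram_det_append_triangular[OF lenh len(2)])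
    show "P x y = 0" if "x \<in> set (lh q)" "y \<in> set (b' q)" for x y
      using that bsub lhsub by (intro cycle_coboundary_orthogonal[OF q]) auto
  qed
  \<comment> \<open>Here the duality of the homology bases enters.\<close>
  also have "gram_det P (lh q) (lh' q) = 1"
  proof (rule gram_det_identity)
    fix i j assume "i < length (lh q)" "j < length (lh q)"
    then have i: "i < length (h q)" and j: "j < length (h' q)"
      using length_representatives[OF q] length_h'[OF q] by simp_all
    have "h q ! i \<in> quot_space (cycles C d q) (boundaries C d 1 q)"
      "h' q ! j \<in> quot_space (cycles C ds q) (boundaries C ds (-1) q)"
      using basis_h[OF q] basis_h'[OF q] nth_mem[OF i] nth_mem[OF j]
      unfolding homology_basis_def quot_ordered_basis_def by blast+
    moreover have "lh q ! i \<in> h q ! i" "lh' q ! j \<in> h' q ! j"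
      using d.homology_representatives[OF aux q] i
        ds.homology_representatives[OF aux' q] j
      by (simp_all add: list_all2_conv_all_nth)
    ultimately have "P (lh q ! i) (lh' q ! j) = induced_pairing P (h q ! i) (h' q ! j)"
      using induced_pairing_eq[OF q] by simp
    then show "P (lh q ! i) (lh' q ! j) = (if i = j then 1 else 0)" using dual_h'[OF q i j] by simp
  qed
  \<comment> \<open>Adjointness: the pairing of a lift with \<open>ds\<close> of a dual lift is that
    of \<open>d\<close> of the lift with the dual lift, so the corner block in degree
    \<open>q\<close> is the Gram matrix of boundaries in degree \<open>q + 1\<close>.\<close>
  also have "gram_det P (bt (q + 1)) (b' q) = boundary_gram (q + 1)"
    unfolding boundary_gram_def
  proof (rule gram_det_cong)
    show "length (bt (q + 1)) = length (b (q + 1))"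
      by (rule d.length_boundary_lifts[OF aux])
    fix i j assume i: "i < length (bt (q + 1))" and "j < length (bt (q + 1))"
    then have j: "j < length (bt' q)" using len ds.length_boundary_lifts[OF aux', of q] by simp
    have "bt (q + 1) ! i \<in> C q" "bt' q ! j \<in> C (q + 1)"
      using d.boundary_lifts(1)[OF aux, of "q + 1"] nth_mem[OF i]
        ds.boundary_lifts(1)[OF aux', of q] nth_mem[OF j] by auto
    then have "P (d (bt (q + 1) ! i)) (bt' q ! j) = P (bt (q + 1) ! i) (ds (bt' q ! j))"
      using d_adjoint[of "bt (q + 1) ! i" "q + 1"] by simp
    moreover have "b (q + 1) ! i = d (bt (q + 1) ! i)"
      using d.boundary_lifts(2)[OF aux, of "q + 1"] i by (metis nth_map)
    moreover have "b' q ! j = ds (bt' q ! j)"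
      using ds.boundary_lifts(2)[OF aux', of q] j by (metis nth_map)
    ultimately show "P (bt (q + 1) ! i) (b' q ! j) = P (b (q + 1) ! i) (bt' (q + 1 - 1) ! j)" by simp
  qed
  finally show ?thesis by simp
qed

text \<open>The number of inversions in reversing three blocks whose lengths are those of
  \<open>b (q + 1)\<close>, \<open>h q\<close> and \<open>b' (q - 1)\<close>; at the same time the
  summand of the exponent in \<open>torsion\<close>.\<close>

definition sign_exponent :: "int \<Rightarrow> nat" where
  "sign_exponent q = length (b' (q - 1)) * length (b (q + 1)) + length (b (q + 1)) * length (h q) +
     length (b' (q - 1)) * length (h q)"

lemma torsion_sign_exponent_eq:
  "torsion_sign_exponent N C d ds = (\<Sum>q\<in>{0..int N}. sign_exponent q)"
  unfolding torsion_sign_exponent_def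
proof (rule sum.cong[OF refl])
  fix q assume q: "q \<in> {0..int N}"
  show "dim (boundaries C ds (-1) (q - 1)) * dim (boundaries C d 1 (q + 1)) +
      dim (boundaries C d 1 (q + 1)) * homology_dim C ds (-1) q +
      dim (boundaries C ds (-1) (q - 1)) * homology_dim C d 1 q = sign_exponent q"
    using d.homology_dim_eq_length[OF basis_h[OF q]] ds.homology_dim_eq_length[OF basis_h'[OF q]]
      d.length_boundary_basis[OF aux] ds.length_boundary_basis[OF aux'] length_h'[OF q]
    by (simp add: sign_exponent_def)
qed

lemma gram_det_adapted_bases:
  assumes q: "q \<in> {0..int N}"
  shows "gram_det P (b q @ lh q @ bt (q + 1)) (b' q @ lh' q @ bt' (q - 1)) =
    (-1) ^ sign_exponent q * (boundary_gram q * boundary_gram (q + 1))"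
proof -
  obtain k where k: "q = int k" "k \<le> N" using q by (metis atLeastAtMost_iff nat_0_le nat_le_iff)
  let ?X = "b q @ lh q @ bt (q + 1)" and ?V = "C q"
  let ?n = "length ?X"
  \<comment> \<open>The Gram determinant as a form in its second list, with the cochain basis held
    fixed.\<close>
  let ?w = "\<lambda>ys. gram_det (\<lambda>x y. P y x) ys ?X"
  have XV: "set ?X \<subseteq> ?V" by (rule ordered_basis_subset[OF cochain_adapted_basis[OF q]])
  have YV: "set (b' q @ lh' q @ bt' (q - 1)) \<subseteq> ?V" by (rule ordered_basis_subset[OF dual_adapted_basis[OF q]])
  have len: "length (b' q @ lh' q @ bt' (q - 1)) = ?n"
    using ordered_basis_length[OF cochain_adapted_basis[OF q]] ordered_basis_length[OF dual_adapted_basis[OF q]] by simp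
  have w: "alternating_form ?V ?n ?w"
    by (rule alternating_form_gram_det[OF bilinear_pairing_flip[OF bilinear[OF q]] refl XV])
  have r: "length (b' q) = length (b (q + 1))" "length (bt' (q - 1)) = length (b' (q - 1))"
    using length_boundary_bases[of "Suc k"] k ds.length_boundary_lifts[OF aux']
    by (simp_all add: add.commute)
  \<comment> \<open>Reversal in two moves: first \<open>b' q\<close> goes to the end, then
    \<open>lh' q\<close> and \<open>bt' (q - 1)\<close> change places.\<close>
  have "?w (b' q @ lh' q @ bt' (q - 1)) =
      (-1) ^ (length (b' q) * length (lh' q @ bt' (q - 1))) * ?w ((lh' q @ bt' (q - 1)) @ b' q)"
    using alternating_form_swap_blocks[OF w subspace_C, of "[]" "b' q" "lh' q @ bt' (q - 1)" "[]"] len YV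
    by simp
  also have "?w ((lh' q @ bt' (q - 1)) @ b' q) =
      (-1) ^ (length (lh' q) * length (bt' (q - 1))) * ?w (bt' (q - 1) @ lh' q @ b' q)"
    using alternating_form_swap_blocks[OF w subspace_C, of "[]" "lh' q" "bt' (q - 1)" "b' q"] len YV
    by simp
  finally have "?w (b' q @ lh' q @ bt' (q - 1)) =
      (-1) ^ sign_exponent q * ?w (bt' (q - 1) @ lh' q @ b' q)"
    using length_representatives[OF q] r
    by (simp add: sign_exponent_def power_add distrib_left mult_ac)
  moreover have "?w (b' q @ lh' q @ bt' (q - 1)) = gram_det P ?X (b' q @ lh' q @ bt' (q - 1))"
    "?w (bt' (q - 1) @ lh' q @ b' q) = gram_det P ?X (bt' (q - 1) @ lh' q @ b' q)"
    using len by (intro gram_det_flip; simp)+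
  ultimately show ?thesis using gram_det_reversed_blocks[OF q] by simp
qed

text \<open>Each base is a Gram determinant, that is, a sign times two consecutive boundary Gram
  determinants, so the alternating product telescopes up to sign.\<close>

lemma alternating_product_ratios:
  "(\<Prod>q\<in>{0..int N}. (basis_ratio (C q) (b q @ lh q @ bt (q + 1)) (c q) *
      basis_ratio (C q) (b' q @ lh' q @ bt' (q - 1)) (c q)) powi ((-1) ^ nat q)) =
    (-1) ^ torsion_sign_exponent N C d ds"
proof -
  let ?r = "\<lambda>q. basis_ratio (C q) (b q @ lh q @ bt (q + 1)) (c q) *
      basis_ratio (C q) (b' q @ lh' q @ bt' (q - 1)) (c q)"
  let ?a = "\<lambda>k. boundary_gram (int k)"
  have r: "?r (int k) = (-1) ^ sign_exponent (int k) * (?a k * ?a (Suc k))" "?r (int k) \<noteq> 0" if "k \<le> N" for k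
  proof -
    have q: "int k \<in> {0..int N}" using that by simp
    show "?r (int k) = (-1) ^ sign_exponent (int k) * (?a k * ?a (Suc k))"
      using basis_ratio_gram_det(3)[OF q cochain_adapted_basis[OF q] dual_adapted_basis[OF q]] gram_det_adapted_bases[OF q]
      by (simp add: add.commute)
    show "?r (int k) \<noteq> 0"
      using basis_ratio_gram_det(1)[OF q cochain_adapted_basis[OF q] dual_adapted_basis[OF q]]
        basis_ratio_gram_det(1)[OF q dual_adapted_basis[OF q] dual_adapted_basis[OF q]] by simp
  qed
  \<comment> \<open>A sign is its own inverse, so alternating exponents leave it unchanged.\<close>
  have sign: "((-1) ^ m) powi ((-1) ^ k) = ((-1) ^ m :: 'a)" for m k :: nat
    by (cases "even m"; cases "even k") simp_all
  have "(\<Prod>k\<le>N. (?a k * ?a (Suc k)) powi ((-1) ^ k)) = ?a 0 * ?a (Suc N) powi ((-1) ^ N)"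
    by (rule prod_power_int_telescope) (use r in fastforce)
  \<comment> \<open>\<open>b 0\<close> and \<open>b (N + 1)\<close> are empty, and an empty Gram
    determinant is 1.\<close>
  also have "\<dots> = 1"
    using boundary_bases_outside by (simp add: boundary_gram_def add.commute)
  finally have tele: "(\<Prod>k\<le>N. (?a k * ?a (Suc k)) powi ((-1) ^ k)) = 1" .
  have "(\<Prod>q\<in>{0..int N}. ?r q powi ((-1) ^ nat q)) = (\<Prod>k\<le>N. ?r (int k) powi ((-1) ^ k))"
    by (simp add: prod_atLeastAtMost_int_of_nat)
  also have "\<dots> = (\<Prod>k\<le>N. (-1) ^ sign_exponent (int k) * (?a k * ?a (Suc k)) powi ((-1) ^ k))"
  proof (rule prod.cong[OF refl])
    fix k assume "k \<in> {..N}"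
    then have "k \<le> N" by simp
    show "?r (int k) powi ((-1) ^ k) = (-1) ^ sign_exponent (int k) * (?a k * ?a (Suc k)) powi ((-1) ^ k)"
      unfolding r(1)[OF \<open>k \<le> N\<close>] power_int_mult_distrib[of "(-1) ^ _"] sign ..
  qed
  also have "\<dots> = (\<Prod>k\<le>N. (-1) ^ sign_exponent (int k))"
    unfolding prod.distrib tele by simp
  also have "\<dots> = (\<Prod>q\<in>{0..int N}. (-1) ^ sign_exponent q)"
    by (simp add: prod_atLeastAtMost_int_of_nat)
  finally show ?thesis by (simp add: torsion_sign_exponent_eq power_sum)
qed

text \<open>The left side involves only the choices for \<open>d\<close>, the right side only those
  for \<open>ds\<close>; hence neither depends on its choices.\<close>

lemma inverse_alternating_product:
  "inverse (\<Prod>q\<in>{0..int N}. basis_ratio (C q) (b q @ lh q @ bt (q + 1)) (c q) powi ((-1) ^ nat q)) =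
    (-1) ^ torsion_sign_exponent N C d ds *
    (\<Prod>q\<in>{0..int N}. basis_ratio (C q) (b' q @ lh' q @ bt' (q - 1)) (c q) powi ((-1) ^ nat q))"
  (is "inverse ?R = ?s * ?U")
proof (rule inverse_unique)
  have "?R * ?U = ?s"
    using alternating_product_ratios by (simp only: power_int_mult_distrib prod.distrib)
  then have "?R * (?s * ?U) = ?s * ?s" by (simp only: mult.left_commute)
  also have "\<dots> = 1" by (simp flip: power_mult_distrib)
  finally show "?R * (?s * ?U) = 1" .
qed

text \<open>Splitting each ratio through \<open>c q\<close> gives a quotient of two alternating
  products. Its numerator, together with the sign, is the inverse of its denominator.\<close>

lemma torsion_expression_eq_square:
  "(-1) ^ torsion_sign_exponent N C d ds *
    (\<Prod>q\<in>{0..int N}. basis_ratio (C q) (b q @ lh q @ bt (q + 1)) (b' q @ lh' q @ bt' (q - 1))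
      powi ((-1) ^ nat (q + 1))) =
    (inverse (\<Prod>q\<in>{0..int N}. basis_ratio (C q) (b q @ lh q @ bt (q + 1)) (c q) powi ((-1) ^ nat q)))\<^sup>2"
proof -
  let ?x = "\<lambda>q. basis_ratio (C q) (b q @ lh q @ bt (q + 1)) (c q)"
    and ?y = "\<lambda>q. basis_ratio (C q) (b' q @ lh' q @ bt' (q - 1)) (c q)"
  have "basis_ratio (C q) (b q @ lh q @ bt (q + 1)) (b' q @ lh' q @ bt' (q - 1)) powi ((-1) ^ nat (q + 1)) =
      ?y q powi ((-1) ^ nat q) / ?x q powi ((-1) ^ nat q)" if q: "q \<in> {0..int N}" for q
  proof -
    \<comment> \<open>For \<open>q\<close> at least 0 the exponent is the opposite of the one in
      \<open>tau\<close>.\<close>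
    have "nat (q + 1) = Suc (nat q)" using q by auto
    then show ?thesis
      unfolding basis_ratio_gram_det(2)[OF q cochain_adapted_basis[OF q] dual_adapted_basis[OF q]]
      by (simp add: power_int_minus power_int_divide_distrib)
  qed
  then have "(\<Prod>q\<in>{0..int N}. basis_ratio (C q) (b q @ lh q @ bt (q + 1)) (b' q @ lh' q @ bt' (q - 1))
        powi ((-1) ^ nat (q + 1))) =
      (\<Prod>q\<in>{0..int N}. ?y q powi ((-1) ^ nat q)) / (\<Prod>q\<in>{0..int N}. ?x q powi ((-1) ^ nat q))"
    by (simp add: prod_dividef)
  then show ?thesis
    using inverse_alternating_product by (simp add: power2_eq_square divide_inverse)
qed

end

text \<open>One fixed dual choice serves for all choices on the side of \<open>d\<close>: every
  candidate value equals the same expression in the dual data.\<close>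

lemma tau_eq:
  assumes aux: "auxiliary_choice N C d 1 h b bt lh"
  shows "tau N C d h c = inverse (\<Prod>q\<in>{0..int N}.
    basis_ratio (C q) (b q @ lh q @ bt (q + 1)) (c q) powi ((-1) ^ nat q))"
proof -
  obtain b' bt' lh' where aux': "auxiliary_choice N C ds (-1) h' b' bt' lh'"
    using ds.auxiliary_choice_exists[OF basis_h'] by blast
  show ?thesis
    unfolding tau_def
  proof (rule the_equality)
    fix t
    assume "\<exists>b bt lh. auxiliary_choice N C d 1 h b bt lh \<and>
      t = inverse (\<Prod>q\<in>{0..int N}. basis_ratio (C q) (b q @ lh q @ bt (q + 1)) (c q) powi ((-1) ^ nat q))"
    then obtain b2 bt2 lh2 where "auxiliary_choice N C d 1 h b2 bt2 lh2"
      and t: "t = inverse (\<Prod>q\<in>{0..int N}.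
        basis_ratio (C q) (b2 q @ lh2 q @ bt2 (q + 1)) (c q) powi ((-1) ^ nat q))"
      by blast
    then show "t = inverse (\<Prod>q\<in>{0..int N}.
        basis_ratio (C q) (b q @ lh q @ bt (q + 1)) (c q) powi ((-1) ^ nat q))"
      using inverse_alternating_product[OF _ aux'] aux by simp
  qed (use aux in blast)
qed

text \<open>Every pair of choices yields the square of \<open>tau\<close>, and such pairs exist, so
  the definite description in \<open>torsion\<close> has exactly this value.\<close>

lemma torsion_eq_tau_squared: "torsion N C d ds h h' = (tau N C d h c)\<^sup>2"
proof -
  obtain b bt lh where aux: "auxiliary_choice N C d 1 h b bt lh"
    using d.auxiliary_choice_exists[OF basis_h] by blast
  obtain b' bt' lh' where aux': "auxiliary_choice N C ds (-1) h' b' bt' lh'"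
    using ds.auxiliary_choice_exists[OF basis_h'] by blast
  show ?thesis
    unfolding torsion_def
  proof (rule the_equality, goal_cases)
    case 1
    have "(tau N C d h c)\<^sup>2 = (-1) ^ torsion_sign_exponent N C d ds *
        (\<Prod>q\<in>{0..int N}. basis_ratio (C q) (b q @ lh q @ bt (q + 1)) (b' q @ lh' q @ bt' (q - 1))
          powi ((-1) ^ nat (q + 1)))"
      unfolding torsion_expression_eq_square[OF aux aux'] tau_eq[OF aux] ..
    with aux aux' show ?case by blast
  next
    case (2 t)
    then obtain b bt lh b' bt' lh' where aux: "auxiliary_choice N C d 1 h b bt lh"
      and aux': "auxiliary_choice N C ds (-1) h' b' bt' lh'"
      and t: "t = (-1) ^ torsion_sign_exponent N C d ds *
        (\<Prod>q\<in>{0..int N}. basis_ratio (C q) (b q @ lh q @ bt (q + 1)) (b' q @ lh' q @ bt' (q - 1))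
          powi ((-1) ^ nat (q + 1)))"
      by blast
    show ?case
      unfolding t torsion_expression_eq_square[OF aux aux'] tau_eq[OF aux] ..
  qed
qed

end

theorem claimA:
  fixes scale :: "complex \<Rightarrow> 'v::ab_group_add \<Rightarrow> 'v"
    and N :: nat
    and C :: "int \<Rightarrow> 'v set"
    and d ds :: "'v \<Rightarrow> 'v"
    and c :: "int \<Rightarrow> 'v list"
    and h h' :: "int \<Rightarrow> 'v set list"
    and P :: "'v \<Rightarrow> 'v \<Rightarrow> complex"
  assumes "cochain_complex scale N C d"
    and "\<And>q. q \<in> {0..int N} \<Longrightarrow> vec_space_over.ordered_basis scale (C q) (c q)"
    and "\<And>q. q \<in> {0..int N} \<Longrightarrow> vec_space_over.homology_basis scale C d 1 q (h q)"
    and "\<And>q. q \<in> {0..int N} \<Longrightarrow> vec_space_over.bilinear_pairing scale (C q) P"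
    and "\<And>q. q \<in> {0..int N} \<Longrightarrow> vec_space_over.nondegenerate_pairing (C q) P"
    and "\<And>q i j. q \<in> {0..int N} \<Longrightarrow> i < length (c q) \<Longrightarrow> j < length (c q) \<Longrightarrow>
           P (c q ! i) (c q ! j) = (if i = j then 1 else 0)"
    and "vec_space_over.transpose_differential scale C P d ds"
    and "\<And>q. q \<in> {0..int N} \<Longrightarrow> vec_space_over.homology_basis scale C ds (-1) q (h' q)"
    and "\<And>q. q \<in> {0..int N} \<Longrightarrow> length (h' q) = length (h q)"
    and "\<And>q i j. q \<in> {0..int N} \<Longrightarrow> i < length (h q) \<Longrightarrow> j < length (h' q) \<Longrightarrow>
           vec_space_over.induced_pairing P (h q ! i) (h' q ! j) = (if i = j then 1 else 0)"
  shows "vec_space_over.torsion scale N C d ds h h' = (vec_space_over.tau scale N C d h c)\<^sup>2"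
proof -
  interpret cochain_complex_dual_homology scale N C d ds c h h' P
    by (intro cochain_complex_dual_homology.intro cochain_complex_dual_homology_axioms.intro assms)
  show ?thesis by (rule torsion_eq_tau_squared)
qed

end
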